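(* Assume the setting and notation of the context, with $B>1$, $B>B_0$, and $\mathbf W\succ\mathbf 0$. Let $\mathcal A_N$ be the set of all maps $\hat{\theta}:\mathcal Y_N\to\mathbb R^{d_\theta}$ with $\sup_{\theta\in\Theta_B}\mathbb E_\theta^{(N)}[\|\hat\theta-\theta\|_2^2]<\infty$. Then there is an absolute constant $c_0>0$ such that $$\inf_{\hat\theta\in\mathcal A_N}\ \sup_{\theta\in\Theta_B}\ \mathbb E_\theta^{(N)}\big[\|\hat\theta-\theta\|_2^2\big]\ \ge\ c_0\,\sigma^2\,\mathrm{tr}(\mathbf W^{-1})\,\min\Big\{\frac1N,\ \frac{\log^2(B/B_0)}{4\mu_Q d_\theta\log(4d)}\Big\},$$ and moreover $$\inf_{\hat\theta\in\mathcal A_N}\ \sup_{\theta\in\Theta_B}\ \mathbb P_\theta^{(N)}\Big\{\|\hat\theta-\theta\|_2^2\ \ge\ \frac{\sigma^2\,\mathrm{tr}(\mathbf W^{-1})}{16}\min\Big\{\frac1N,\ \frac{\log^2(B/B_0)}{4\mu_Q d_\theta\log(4d)}\Big\}\Big\}\ \ge\ \frac1{15}.$$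
   Context: Model (Bradley–Terry–Luce with linear-in-parameter utility). Fix an integer $d\ge2$, feature vectors $\phi(\mathbf x_1),\dots,\phi(\mathbf x_d)\in\mathbb R^p$, the matrix $\mathfrak A\in\mathbb R^{d\times p}$ with rows $\phi(\mathbf x_i)^\top$, a scale $\sigma>0$, and a consistent linear system $\mathbf A\mathbf w=\mathbf b$ with $\mathbf A\in\mathbb R^{l\times p}$, $\mathbf b\in\mathbb R^l$. Let $r_A=\mathrm{rank}(\mathbf A)$, $d_\theta=p-r_A\ge1$, let $\mathbf V\in\mathbb R^{p\times d_\theta}$ have orthonormal columns spanning $\mathrm{Null}(\mathbf A)$, and $\mathbf w_o=\mathbf A^\dagger\mathbf b$. Feasible parameters are $\mathbf w=\mathbf w_o+\mathbf V\theta$, $\theta\in\mathbb R^{d_\theta}$. Design: a nonempty set of queries $\mathcal E_s\subseteq\{(i,j):1\le i<j\le d\}$ and integers $n_\alpha\ge1$ ($\alpha\in\mathcal E_s$); $N=\sum_{\alpha\in\mathcal E_s}n_\alpha$. For $\alpha=(i,j)$: $\mathbf a_\alpha=\mathfrak A^\top(\mathbf e_i-\mathbf e_j)$, $\mathbf q_\alpha=\mathbf V^\top\mathbf a_\alpha$, $\eta_\alpha(\theta)=(\mathbf w_o^\top\mathbf a_\alpha+\mathbf q_\alpha^\top\theta)/\sigma$. Responses: $Y^{(N)}=(Y_\alpha^{(t)})_{\alpha\in\mathcal E_s,t\in[n_\alpha]}\in\mathcal Y_N:=\{0,1\}^N$. Under $\mathbb P_\theta^{(N)}$ (expectation $\mathbb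 E_\theta^{(N)}$) the coordinates are independent and $Y_\alpha^{(t)}$ is Bernoulli with success probability $1/(1+e^{-\eta_\alpha(\theta)})$. An estimator $\hat\theta$ means $\hat\theta(Y^{(N)})$. Design matrix: $\mathbf W=\frac1N\sum_{\alpha\in\mathcal E_s}n_\alpha\mathbf q_\alpha\mathbf q_\alpha^\top\in\mathbb R^{d_\theta\times d_\theta}$. Coherence level (when $\mathbf W\succ\mathbf 0$): $\mu_Q=\max_{\alpha\in\mathcal E_s}\frac1{d_\theta}\mathbf q_\alpha^\top\mathbf W^{-1}\mathbf q_\alpha$. Parameter set: $\Theta_B=\{\theta\in\mathbb R^{d_\theta}:|\eta_\alpha(\theta)|\le\log B\ \forall\alpha\in\mathcal E_s\}$. The constant $B_0$ is defined by $\log B_0=\max_{\alpha\in\mathcal E_s}|\mathbf w_o^\top\mathbf a_\alpha/\sigma|$. "Absolute constant" means a number independent of all quantities in the problem. *)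

theory Defs
  imports
    "HOL-Probability.Probability"
    "Jordan_Normal_Form.Gauss_Jordan_Elimination"
    "Jordan_Normal_Form.Matrix_Kernel"
    "Jordan_Normal_Form.DL_Rank"
begin

text \<open>
  All dimensions are natural numbers carried by the data (vectors and matrices over explicit
  carriers), so that a constant chosen before the data is independent of the dimensions too.
  Items, features and matrix indices are counted from \<open>0\<close>.
\<close>

definition sq_norm2 :: "real vec \<Rightarrow> real" where
  "sq_norm2 v = v \<bullet> v"

definition mat_trace :: "real mat \<Rightarrow> real" where
  "mat_trace M = (\<Sum>i<dim_row M. M $$ (i, i))"

definition pos_def_mat :: "real mat \<Rightarrow> bool" where
  "pos_def_mat M \<longleftrightarrow> square_mat M \<and> transpose_mat M = M \<and>
     (\<forall>x \<in> carrier_vec (dim_row M). x \<noteq> 0\<^sub>v (dim_row M) \<longrightarrow> x \<bullet> (M *\<^sub>v x) > 0)"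

text \<open>The Moore-Penrose inverse, through the four Penrose equations, which have exactly one
  solution for every real matrix.\<close>

definition is_pseudo_inverse :: "real mat \<Rightarrow> real mat \<Rightarrow> bool" where
  "is_pseudo_inverse A X \<longleftrightarrow> X \<in> carrier_mat (dim_col A) (dim_row A) \<and>
     A * X * A = A \<and> X * A * X = X \<and>
     transpose_mat (A * X) = A * X \<and> transpose_mat (X * A) = X * A"

definition pseudo_inverse :: "real mat \<Rightarrow> real mat" where
  "pseudo_inverse A = (THE X. is_pseudo_inverse A X)"

text \<open>\<open>feature i\<close> is the vector \<open>\<phi>(x\<^sub>i)\<close>; \<open>con_mat w = con_rhs\<close> is the linear system
  \<open>A w = b\<close>; \<open>null_mat\<close> is \<open>V\<close>; \<open>reps \<alpha>\<close> is \<open>n\<^sub>\<alpha>\<close>.\<close>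

record btl_model =
  num_items :: nat
  num_features :: nat
  num_constraints :: nat
  feature :: "nat \<Rightarrow> real vec"
  scale :: real
  con_mat :: "real mat"
  con_rhs :: "real vec"
  null_mat :: "real mat"
  queries :: "(nat \<times> nat) set"
  reps :: "nat \<times> nat \<Rightarrow> nat"

definition con_rank :: "btl_model \<Rightarrow> nat" where
  "con_rank M = vec_space.rank (num_constraints M) (con_mat M)"

definition theta_dim :: "btl_model \<Rightarrow> nat" where
  "theta_dim M = num_features M - con_rank M"

definition btl_setting :: "btl_model \<Rightarrow> bool" where
  "btl_setting M \<longleftrightarrow>
     num_items M \<ge> 2 \<and>
     (\<forall>i < num_items M. feature M i \<in> carrier_vec (num_features M)) \<and>
     scale M > 0 \<and>
     con_mat M \<in> carrier_mat (num_constraints M) (num_features M) \<and>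
     con_rhs M \<in> carrier_vec (num_constraints M) \<and>
     (\<exists>w \<in> carrier_vec (num_features M). con_mat M *\<^sub>v w = con_rhs M) \<and>
     theta_dim M \<ge> 1 \<and>
     null_mat M \<in> carrier_mat (num_features M) (theta_dim M) \<and>
     transpose_mat (null_mat M) * null_mat M = 1\<^sub>m (theta_dim M) \<and>
     vec_space.col_space (num_features M) (null_mat M) = mat_kernel (con_mat M) \<and>
     queries M \<noteq> {} \<and>
     queries M \<subseteq> {(i, j). i < j \<and> j < num_items M} \<and>
     (\<forall>\<alpha> \<in> queries M. reps M \<alpha> \<ge> 1)"

definition feature_mat :: "btl_model \<Rightarrow> real mat" where
  "feature_mat M = mat_of_rows (num_features M) (map (feature M) [0..<num_items M])"

definition w_off :: "btl_model \<Rightarrow> real vec" where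
  "w_off M = pseudo_inverse (con_mat M) *\<^sub>v con_rhs M"

definition a_vec :: "btl_model \<Rightarrow> nat \<times> nat \<Rightarrow> real vec" where
  "a_vec M = (\<lambda>(i, j). transpose_mat (feature_mat M) *\<^sub>v
     (unit_vec (num_items M) i - unit_vec (num_items M) j))"

definition q_vec :: "btl_model \<Rightarrow> nat \<times> nat \<Rightarrow> real vec" where
  "q_vec M \<alpha> = transpose_mat (null_mat M) *\<^sub>v a_vec M \<alpha>"

definition eta :: "btl_model \<Rightarrow> real vec \<Rightarrow> nat \<times> nat \<Rightarrow> real" where
  "eta M \<theta> \<alpha> = (w_off M \<bullet> a_vec M \<alpha> + q_vec M \<alpha> \<bullet> \<theta>) / scale M"

definition sample_size :: "btl_model \<Rightarrow> nat" where
  "sample_size M = (\<Sum>\<alpha> \<in> queries M. reps M \<alpha>)"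

definition design_mat :: "btl_model \<Rightarrow> real mat" where
  "design_mat M = Matrix.mat (theta_dim M) (theta_dim M) (\<lambda>(r, c).
     1 / real (sample_size M) *
       (\<Sum>\<alpha> \<in> queries M. real (reps M \<alpha>) * (q_vec M \<alpha> $ r * q_vec M \<alpha> $ c)))"

text \<open>Meaningful only for invertible \<open>design_mat M\<close>, as \<open>mat_inverse\<close> returns an option.\<close>

definition design_inv :: "btl_model \<Rightarrow> real mat" where
  "design_inv M = the (mat_inverse (design_mat M))"

definition coherence :: "btl_model \<Rightarrow> real" where
  "coherence M = Max ((\<lambda>\<alpha>. 1 / real (theta_dim M) *
     (q_vec M \<alpha> \<bullet> (design_inv M *\<^sub>v q_vec M \<alpha>))) ` queries M)"

definition param_set :: "btl_model \<Rightarrow> real \<Rightarrow> real vec set" where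
  "param_set M B = {\<theta> \<in> carrier_vec (theta_dim M). \<forall>\<alpha> \<in> queries M. \<bar>eta M \<theta> \<alpha>\<bar> \<le> ln B}"

definition B_zero :: "btl_model \<Rightarrow> real" where
  "B_zero M = exp (Max ((\<lambda>\<alpha>. \<bar>(w_off M \<bullet> a_vec M \<alpha>) / scale M\<bar>) ` queries M))"

text \<open>A response vector assigns a Boolean (\<open>True\<close> for 1) to every index \<open>(\<alpha>, t)\<close>; by the convention
  of \<open>Pi_pmf\<close> it is \<open>False\<close> outside the index set.\<close>

definition obs_index :: "btl_model \<Rightarrow> ((nat \<times> nat) \<times> nat) set" where
  "obs_index M = (SIGMA \<alpha> : queries M. {..<reps M \<alpha>})"

definition responses :: "btl_model \<Rightarrow> ((nat \<times> nat) \<times> nat \<Rightarrow> bool) set" where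
  "responses M = PiE_dflt (obs_index M) False (\<lambda>_. UNIV)"

definition response_pmf :: "btl_model \<Rightarrow> real vec \<Rightarrow> ((nat \<times> nat) \<times> nat \<Rightarrow> bool) pmf" where
  "response_pmf M \<theta> = Pi_pmf (obs_index M) False
     (\<lambda>(\<alpha>, t). bernoulli_pmf (1 / (1 + exp (- eta M \<theta> \<alpha>))))"

text \<open>Risks and probabilities are taken in \<open>ennreal\<close>, where suprema always exist and an
  unbounded supremum is \<open>\<infinity>\<close>.\<close>

definition risk ::
  "btl_model \<Rightarrow> (((nat \<times> nat) \<times> nat \<Rightarrow> bool) \<Rightarrow> real vec) \<Rightarrow> real vec \<Rightarrow> ennreal" where
  "risk M est \<theta> = (\<integral>\<^sup>+ y. ennreal (sq_norm2 (est y - \<theta>)) \<partial>measure_pmf (response_pmf M \<theta>))"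

definition estimators ::
  "btl_model \<Rightarrow> real \<Rightarrow> (((nat \<times> nat) \<times> nat \<Rightarrow> bool) \<Rightarrow> real vec) set" where
  "estimators M B = {est \<in> responses M \<rightarrow>\<^sub>E carrier_vec (theta_dim M).
     (SUP \<theta> \<in> param_set M B. risk M est \<theta>) < \<infinity>}"

definition min_rate :: "btl_model \<Rightarrow> real \<Rightarrow> real" where
  "min_rate M B = min (1 / real (sample_size M))
     ((ln (B / B_zero M))\<^sup>2 /
        (4 * coherence M * real (theta_dim M) * ln (4 * real (num_items M))))"

end

theory Submission
  imports Defs
begin

text \<open>
  Let \<open>(u\<^sub>k, \<lambda>\<^sub>k)\<close> be an orthonormal eigenbasis of \<open>W\<close>, let \<open>\<delta>\<^sup>2\<close> be the minimum in the
  rate, and put a uniform prior on the sign vectors \<open>\<epsilon>\<close> of the hypercube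
  \<open>\<theta>\<^sub>\<epsilon> = \<sigma> \<delta> \<Sum>\<^sub>k \<epsilon>\<^sub>k \<lambda>\<^sub>k\<^sup>-\<^sup>1\<^sup>/\<^sup>2 u\<^sub>k\<close>. Each \<open>q\<^sub>\<alpha> \<bullet> \<theta>\<^sub>\<epsilon> / \<sigma>\<close> is a Rademacher sum with variance proxy
  \<open>\<delta>\<^sup>2 q\<^sub>\<alpha> \<bullet> W\<^sup>-\<^sup>1 q\<^sub>\<alpha> \<le> \<delta>\<^sup>2 \<mu> d\<^sub>\<theta>\<close>, so by Hoeffding and a union bound over fewer than \<open>d\<^sup>2/2\<close> queries
  all but a fraction \<open>1/16\<close> of the cube lies in \<open>\<Theta>\<^sub>B\<close>. Flipping one sign moves the logits
  by at most \<open>4\<close> in summed squares, so the Hellinger affinity of the two response laws satisfies \<open>BC\<^sup>2 \<ge> 3/4\<close>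
  and no test recovers a sign with average error below \<open>1/4\<close>. By Parseval a wrong \<open>k\<close>-th sign costs
  at least \<open>\<sigma>\<^sup>2 \<delta>\<^sup>2 / \<lambda>\<^sub>k\<close>, and these costs sum to \<open>\<sigma>\<^sup>2 \<delta>\<^sup>2 tr W\<^sup>-\<^sup>1\<close>. The bound on the
  risk follows from the bound on the probability by Markov's inequality, with constant \<open>1/240\<close>.
\<close>

section \<open>Orthonormal eigenbases of real symmetric matrices\<close>

text \<open>Vectors are functions on \<open>nat\<close> of which only the first \<open>n\<close>
  coordinates count. The dimension stays a variable, and the product topology on functions supplies
  the compactness used in \<open>rayleigh_minimiser\<close>.\<close>

definition dot :: "nat \<Rightarrow> (nat \<Rightarrow> real) \<Rightarrow> (nat \<Rightarrow> real) \<Rightarrow> real" where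
  "dot n x y = (\<Sum>i<n. x i * y i)"

definition mat_app :: "nat \<Rightarrow> (nat \<Rightarrow> nat \<Rightarrow> real) \<Rightarrow> (nat \<Rightarrow> real) \<Rightarrow> nat \<Rightarrow> real" where
  "mat_app n A x i = (\<Sum>j<n. A i j * x j)"

definition orthonormal_family :: "nat \<Rightarrow> nat \<Rightarrow> (nat \<Rightarrow> nat \<Rightarrow> real) \<Rightarrow> bool" where
  "orthonormal_family n k u \<longleftrightarrow> (\<forall>a<k. \<forall>b<k. dot n (u a) (u b) = of_bool (a = b))"

lemma dot_commute: "dot n x y = dot n y x"
  by (simp add: dot_def mult.commute)

lemma dot_add_left: "dot n (\<lambda>i. x i + y i) z = dot n x z + dot n y z"
  and dot_scale_left: "dot n (\<lambda>i. c * x i) z = c * dot n x z"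
  and dot_add_right: "dot n z (\<lambda>i. x i + y i) = dot n z x + dot n z y"
  and dot_diff_right: "dot n z (\<lambda>i. x i - y i) = dot n z x - dot n z y"
  and dot_scale_right: "dot n z (\<lambda>i. c * x i) = c * dot n z x"
  by (simp_all add: dot_def algebra_simps sum.distrib sum_subtractf sum_distrib_left)

lemma dot_sum_right: "dot n z (\<lambda>i. \<Sum>a\<in>S. c a * u a i) = (\<Sum>a\<in>S. c a * dot n z (u a))"
proof -
  have "dot n z (\<lambda>i. \<Sum>a\<in>S. c a * u a i) = (\<Sum>i<n. \<Sum>a\<in>S. c a * (z i * u a i))"
    by (simp add: dot_def sum_distrib_left mult_ac)
  also have "\<dots> = (\<Sum>a\<in>S. \<Sum>i<n. c a * (z i * u a i))"
    by (rule sum.swap)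
  finally show ?thesis
    by (simp add: dot_def sum_distrib_left)
qed

lemma dot_nonneg: "dot n x x \<ge> 0"
  by (simp add: dot_def sum_nonneg)

lemma dot_eq_0_iff: "dot n x x = 0 \<longleftrightarrow> (\<forall>i<n. x i = 0)"
  by (simp add: dot_def sum_nonneg_eq_0_iff Ball_def)

lemma dot_cong: "(\<And>i. i < n \<Longrightarrow> x i = x' i) \<Longrightarrow> (\<And>i. i < n \<Longrightarrow> y i = y' i) \<Longrightarrow> dot n x y = dot n x' y'"
  by (simp add: dot_def)

lemma mat_app_add: "mat_app n A (\<lambda>i. x i + y i) = (\<lambda>i. mat_app n A x i + mat_app n A y i)"
  and mat_app_scale: "mat_app n A (\<lambda>i. c * x i) = (\<lambda>i. c * mat_app n A x i)"
  by (simp_all add: fun_eq_iff mat_app_def algebra_simps sum.distrib sum_distrib_left)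

lemma mat_app_cong: "(\<And>i. i < n \<Longrightarrow> x i = y i) \<Longrightarrow> mat_app n A x = mat_app n A y"
  by (simp add: fun_eq_iff mat_app_def)

lemma dot_mat_app_symmetric:
  assumes "\<And>i j. i < n \<Longrightarrow> j < n \<Longrightarrow> A i j = A j i"
  shows "dot n x (mat_app n A y) = dot n y (mat_app n A x)"
proof -
  have "dot n x (mat_app n A y) = (\<Sum>i<n. \<Sum>j<n. x i * A i j * y j)"
    by (simp add: dot_def mat_app_def sum_distrib_left mult_ac)
  also have "\<dots> = (\<Sum>j<n. \<Sum>i<n. x i * A i j * y j)"
    by (rule sum.swap)
  also have "\<dots> = dot n y (mat_app n A x)"
    by (auto simp: dot_def mat_app_def sum_distrib_left mult_ac assms intro!: sum.cong)
  finally show ?thesis .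
qed

section \<open>Projections onto orthogonal complements, completeness and Parseval\<close>

definition residual :: "nat \<Rightarrow> (nat \<Rightarrow> nat \<Rightarrow> real) \<Rightarrow> nat \<Rightarrow> nat \<Rightarrow> real" where
  "residual k u j i = of_bool (i = j) - (\<Sum>a<k. u a j * u a i)"

lemma residual_orthogonal:
  assumes "orthonormal_family n k u" "b < k" "j < n"
  shows "dot n (u b) (residual k u j) = 0"
proof -
  have "dot n (u b) (residual k u j)
      = dot n (u b) (\<lambda>i. of_bool (i = j)) - (\<Sum>a<k. u a j * dot n (u b) (u a))"
    unfolding residual_def by (simp add: dot_diff_right dot_sum_right)
  also have "dot n (u b) (\<lambda>i. of_bool (i = j)) = u b j"
    using assms by (simp add: dot_def of_bool_def if_distrib cong: if_cong)
  also have "(\<Sum>a<k. u a j * dot n (u b) (u a)) = (\<Sum>a<k. u a j * of_bool (b = a))"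
    using assms by (intro sum.cong) (auto simp: orthonormal_family_def)
  also have "\<dots> = u b j"
    using assms by (simp add: of_bool_def if_distrib cong: if_cong)
  finally show ?thesis by simp
qed

text \<open>\<open>residual k u j\<close> is the projection of the \<open>j\<close>-th unit vector
  onto the orthogonal complement of the family, so its squared length equals its own
  \<open>j\<close>-th coordinate. The sum is the trace of that projection.\<close>

lemma sum_residual_squares:
  assumes "orthonormal_family n k u"
  shows "(\<Sum>j<n. dot n (residual k u j) (residual k u j)) = real n - real k"
proof -
  have "dot n (residual k u j) (residual k u j) = 1 - (\<Sum>a<k. u a j * u a j)" if "j < n" for j
  proof -
    have "dot n (residual k u j) (residual k u j)
        = dot n (residual k u j) (\<lambda>i. of_bool (i = j) - (\<Sum>a<k. u a j * u a i))"
      by (simp only: residual_def[abs_def])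
    also have "\<dots> = dot n (residual k u j) (\<lambda>i. of_bool (i = j))
        - (\<Sum>a<k. u a j * dot n (residual k u j) (u a))"
      by (simp add: dot_diff_right dot_sum_right)
    also have "(\<Sum>a<k. u a j * dot n (residual k u j) (u a)) = 0"
      using residual_orthogonal[OF assms _ that] by (simp add: dot_commute)
    also have "dot n (residual k u j) (\<lambda>i. of_bool (i = j)) = residual k u j j"
      using that by (simp add: dot_def of_bool_def if_distrib cong: if_cong)
    finally show ?thesis by (simp add: residual_def[of k u j j])
  qed
  then have "(\<Sum>j<n. dot n (residual k u j) (residual k u j))
      = real n - (\<Sum>j<n. \<Sum>a<k. u a j * u a j)"
    by (simp add: sum_subtractf)
  also have "(\<Sum>j<n. \<Sum>a<k. u a j * u a j) = (\<Sum>a<k. dot n (u a) (u a))"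
    unfolding dot_def by (rule sum.swap)
  also have "\<dots> = real k"
    using assms by (simp add: orthonormal_family_def)
  finally show ?thesis .
qed

text \<open>Since \<open>n - k > 0\<close>, the residuals cannot all vanish; a nonzero one is
  normalised.\<close>

lemma unit_vector_orthogonal_to_family:
  assumes "orthonormal_family n k u" "k < n"
  obtains x where "dot n x x = 1" "\<And>a. a < k \<Longrightarrow> dot n (u a) x = 0"
proof -
  have "\<exists>j<n. dot n (residual k u j) (residual k u j) \<noteq> 0"
  proof (rule ccontr)
    assume "\<not> ?thesis"
    then show False using sum_residual_squares[OF assms(1)] assms(2) by simp
  qed
  then obtain j where j: "j < n" "dot n (residual k u j) (residual k u j) \<noteq> 0" by blast
  define r where "r = residual k u j"
  define s where "s = sqrt (dot n r r)"
  have "s \<noteq> 0" "s * s = dot n r r"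
    using j dot_nonneg[of n r] by (auto simp: s_def r_def)
  show ?thesis
  proof (rule that)
    show "dot n (\<lambda>i. (1 / s) * r i) (\<lambda>i. (1 / s) * r i) = 1"
      using \<open>s \<noteq> 0\<close> unfolding dot_scale_left dot_scale_right \<open>s * s = dot n r r\<close>[symmetric] by simp
    show "dot n (u a) (\<lambda>i. (1 / s) * r i) = 0" if "a < k" for a
      unfolding dot_scale_right using residual_orthogonal[OF assms(1) that j(1)] by (simp add: r_def)
  qed
qed

text \<open>For \<open>k = n\<close> the squared lengths of the residuals sum to \<open>0\<close>,
  so every unit vector equals its expansion in the family.\<close>

lemma orthonormal_family_complete:
  assumes "orthonormal_family n n u" "i < n" "j < n"
  shows "(\<Sum>a<n. u a i * u a j) = of_bool (i = j)"
proof -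
  have "\<forall>j\<in>{..<n}. dot n (residual n u j) (residual n u j) = 0"
    using sum_residual_squares[OF assms(1)] by (simp add: sum_nonneg_eq_0_iff dot_nonneg)
  then have "residual n u i j = 0"
    using assms by (simp add: dot_eq_0_iff)
  then show ?thesis by (auto simp: residual_def)
qed

lemma parseval:
  assumes "orthonormal_family n n u"
  shows "dot n x x = (\<Sum>a<n. (dot n (u a) x)\<^sup>2)"
proof -
  have "(\<Sum>a<n. (dot n (u a) x)\<^sup>2) = (\<Sum>a<n. \<Sum>i<n. \<Sum>j<n. (u a i * u a j) * (x i * x j))"
    by (simp add: dot_def power2_eq_square sum_product mult_ac)
  also have "\<dots> = (\<Sum>i<n. \<Sum>a<n. \<Sum>j<n. (u a i * u a j) * (x i * x j))"
    by (rule sum.swap)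
  also have "\<dots> = (\<Sum>i<n. \<Sum>j<n. \<Sum>a<n. (u a i * u a j) * (x i * x j))"
    by (intro sum.cong refl sum.swap)
  also have "\<dots> = (\<Sum>i<n. \<Sum>j<n. of_bool (i = j) * (x i * x j))"
    by (intro sum.cong refl)
       (simp add: sum_distrib_right[symmetric] orthonormal_family_complete[OF assms])
  also have "\<dots> = dot n x x"
    by (simp add: dot_def of_bool_def if_distrib[of "\<lambda>c. c * _"] cong: if_cong)
  finally show ?thesis by simp
qed

section \<open>Rayleigh quotients and the spectral theorem\<close>

lemma rayleigh_minimiser:
  assumes "orthonormal_family n k u" "k < n"
  obtains x where "dot n x x = 1" "\<And>a. a < k \<Longrightarrow> dot n (u a) x = 0"
    "\<And>y. (\<And>a. a < k \<Longrightarrow> dot n (u a) y = 0) \<Longrightarrow>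
      dot n x (mat_app n A x) * dot n y y \<le> dot n y (mat_app n A y)"
proof -
  define C where "C = {x. dot n x x = 1 \<and> (\<forall>a<k. dot n (u a) x = 0)}"
  \<comment> \<open>\<open>C\<close> restricts only the first \<open>n\<close> coordinates and so is
    not compact; pinning all the others to \<open>0\<close> gives a product of compact sets.\<close>
  define P where "P = Pi\<^sub>E UNIV (\<lambda>i. if i < n then {-1..1::real} else {0})"
  define f where "f x = dot n x (mat_app n A x)" for x
  have cont: "continuous_on UNIV (\<lambda>x::nat \<Rightarrow> real. x i)" for i
    by simp
  have "compactin (product_topology (\<lambda>i. euclidean) UNIV) P"
    unfolding P_def by (subst compactin_PiE) auto
  then have "compact P"
    by (simp only: euclidean_product_topology compactin_euclidean_iff)
  moreover have "closed C"
  proof -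
    have "C = {x. dot n x x = 1} \<inter> (\<Inter>a\<in>{..<k}. {x. dot n (u a) x = 0})"
      by (auto simp: C_def)
    moreover have "closed {x. dot n x x = 1}"
      unfolding dot_def by (intro closed_Collect_eq continuous_intros cont)
    moreover have "closed {x. dot n (u a) x = 0}" for a
      unfolding dot_def by (intro closed_Collect_eq continuous_intros cont)
    ultimately show ?thesis by auto
  qed
  ultimately have cpt: "compact (P \<inter> C)"
    by (rule compact_Int_closed)
  \<comment> \<open>Truncation changes none of the inner products, so restricting to
    \<open>P\<close> loses no value of \<open>f\<close>.\<close>
  have trunc: "(\<lambda>i. if i < n then x i else 0) \<in> P \<inter> C" if "x \<in> C" for x
  proof -
    have "\<bar>x i\<bar> \<le> 1" if "i < n" for i
    proof -
      have "x i * x i \<le> dot n x x"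
        unfolding dot_def using that by (intro member_le_sum) auto
      also have "\<dots> = 1" using \<open>x \<in> C\<close> by (simp add: C_def)
      finally show ?thesis by (metis abs_le_square_iff abs_1 one_power2 power2_eq_square)
    qed
    then have "(\<lambda>i. if i < n then x i else 0) \<in> P"
      by (force simp: P_def abs_le_iff)
    moreover have "(\<lambda>i. if i < n then x i else 0) \<in> C"
      using that by (auto simp: C_def dot_def)
    ultimately show ?thesis by simp
  qed
  obtain x0 where "x0 \<in> C"
    using unit_vector_orthogonal_to_family[OF assms] by (auto simp: C_def)
  then have ne: "P \<inter> C \<noteq> {}"
    using trunc by blast
  have "continuous_on (P \<inter> C) f"
    unfolding f_def dot_def mat_app_def
    by (intro continuous_intros continuous_on_subset[OF cont]) auto
  then obtain x where x: "x \<in> P \<inter> C" "\<And>y. y \<in> P \<inter> C \<Longrightarrow> f x \<le> f y"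
    using continuous_attains_inf[OF cpt ne] by blast
  show ?thesis
  proof (rule that[of x])
    show "dot n x x = 1" "\<And>a. a < k \<Longrightarrow> dot n (u a) x = 0"
      using x by (auto simp: C_def)
    fix y assume y: "\<And>a. a < k \<Longrightarrow> dot n (u a) y = 0"
    have "f x * dot n y y \<le> f y"
    proof (cases "dot n y y = 0")
      case True
      then have "f y = 0" by (simp add: f_def dot_eq_0_iff) (simp add: dot_def)
      then show ?thesis using True by simp
    next
      case False
      \<comment> \<open>The form and the squared length are both homogeneous of degree
        \<open>2\<close>, so it suffices to compare on the unit sphere.\<close>
      define s where "s = 1 / sqrt (dot n y y)"
      have pos: "dot n y y > 0"
        using False dot_nonneg[of n y] by simp
      then have s: "s * (s * dot n y y) = 1"
        by (simp add: s_def)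
      define z where "z i = s * y i" for i
      have "z \<in> C"
        using y s by (simp add: C_def z_def[abs_def] dot_scale_left dot_scale_right)
      have "f x \<le> f (\<lambda>i. if i < n then z i else 0)"
        using x(2) trunc[OF \<open>z \<in> C\<close>] by blast
      also have "\<dots> = f z"
        unfolding f_def dot_def mat_app_def by simp
      also have "f z = s * (s * f y)"
        by (simp add: f_def z_def[abs_def] mat_app_scale dot_scale_left dot_scale_right)
      also have "\<dots> = f y / dot n y y"
        using pos by (simp add: s_def)
      finally show ?thesis using pos by (simp add: pos_le_divide_eq)
    qed
    then show "dot n x (mat_app n A x) * dot n y y \<le> dot n y (mat_app n A y)"
      by (simp add: f_def)
  qed
qed

text \<open>If \<open>s > 0\<close>, the linear term wins for small negative \<open>t\<close>. The
  choice \<open>t = - e\<close> with \<open>e = s / (\<bar>c\<bar> + 1)\<close> is small enough,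
  because then \<open>e * c \<le> s < 2 * s\<close>.\<close>

lemma nonneg_quadratic_imp_linear_term_nonpos:
  fixes s c :: real
  assumes "\<And>t. 0 \<le> 2 * t * s + t\<^sup>2 * c"
  shows "s \<le> 0"
proof (rule ccontr)
  assume "\<not> s \<le> 0"
  define e where "e = s / (\<bar>c\<bar> + 1)"
  have "e > 0" using \<open>\<not> s \<le> 0\<close> by (simp add: e_def)
  have "e * c \<le> e * (\<bar>c\<bar> + 1)" using \<open>e > 0\<close> by (intro mult_left_mono) auto
  also have "\<dots> = s" by (simp add: e_def)
  finally have "e * (e * c - 2 * s) < 0"
    using \<open>e > 0\<close> \<open>\<not> s \<le> 0\<close> by (intro mult_pos_neg) auto
  then show False
    using assms[of "- e"] by (simp add: algebra_simps power2_eq_square)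
qed

text \<open>A minimiser of the Rayleigh quotient on the orthogonal complement of the eigenvectors found
  so far is again an eigenvector, since the form is nonnegative after subtracting its minimum.\<close>

lemma next_eigenvector:
  assumes sym: "\<And>i j. i < n \<Longrightarrow> j < n \<Longrightarrow> A i j = A j i"
    and u: "orthonormal_family n k u" "k < n"
    and eig: "\<And>a i. a < k \<Longrightarrow> i < n \<Longrightarrow> mat_app n A (u a) i = l a * u a i"
  obtains x m where "dot n x x = 1" "\<And>a. a < k \<Longrightarrow> dot n (u a) x = 0"
    "\<And>i. i < n \<Longrightarrow> mat_app n A x i = m * x i"
proof -
  obtain x where x: "dot n x x = 1" "\<And>a. a < k \<Longrightarrow> dot n (u a) x = 0"
    and min: "\<And>y. (\<And>a. a < k \<Longrightarrow> dot n (u a) y = 0) \<Longrightarrow>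
      dot n x (mat_app n A x) * dot n y y \<le> dot n y (mat_app n A y)"
    using rayleigh_minimiser[OF u] by metis
  define m where "m = dot n x (mat_app n A x)"
  \<comment> \<open>Half the gradient of the Rayleigh quotient at \<open>x\<close>. By symmetry it
    is orthogonal to the earlier eigenvectors, so every \<open>x + t * z\<close> is admissible in
    \<open>min\<close>.\<close>
  define z where "z i = mat_app n A x i - m * x i" for i
  have z: "dot n (u a) z = 0" if "a < k" for a
  proof -
    have "dot n (u a) (mat_app n A x) = dot n x (mat_app n A (u a))"
      by (rule dot_mat_app_symmetric[OF sym])
    also have "\<dots> = dot n x (\<lambda>i. l a * u a i)"
      using eig[OF that] by (intro dot_cong) auto
    also have "\<dots> = 0"
      using x(2)[OF that] by (simp add: dot_scale_right dot_commute)
    finally show ?thesis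
      using x(2)[OF that] by (simp add: z_def[abs_def] dot_diff_right dot_scale_right)
  qed
  have zz: "dot n z z = dot n z (mat_app n A x) - m * dot n z x"
    by (subst (2) z_def[abs_def]) (simp add: dot_diff_right dot_scale_right)
  \<comment> \<open>By \<open>zz\<close> the linear coefficient along \<open>x + t * z\<close> is
    the squared length of \<open>z\<close> itself, so minimality forces \<open>z\<close> to
    vanish.\<close>
  have "0 \<le> 2 * t * dot n z z + t\<^sup>2 * (dot n z (mat_app n A z) - m * dot n z z)" for t
  proof -
    define y where "y i = x i + t * z i" for i
    have "m * dot n y y \<le> dot n y (mat_app n A y)"
      unfolding m_def by (rule min) (simp add: y_def[abs_def] dot_add_right dot_scale_right x z)
    moreover have "dot n y y = 1 + 2 * t * dot n z x + t\<^sup>2 * dot n z z"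
      by (simp add: y_def[abs_def] dot_add_right dot_add_left dot_scale_right dot_scale_left x
          dot_commute[of n x z] algebra_simps power2_eq_square)
    moreover have "dot n y (mat_app n A y)
        = m + 2 * t * dot n z (mat_app n A x) + t\<^sup>2 * dot n z (mat_app n A z)"
      by (simp add: y_def[abs_def] mat_app_add mat_app_scale dot_add_right dot_add_left
          dot_scale_right dot_scale_left m_def dot_mat_app_symmetric[OF sym, where x = x and y = z]
          algebra_simps power2_eq_square)
    ultimately show ?thesis
      by (simp add: zz algebra_simps)
  qed
  then have "dot n z z \<le> 0"
    by (rule nonneg_quadratic_imp_linear_term_nonpos)
  then have "dot n z z = 0"
    using dot_nonneg[of n z] by simp
  then have "\<And>i. i < n \<Longrightarrow> mat_app n A x i = m * x i"
    by (simp add: dot_eq_0_iff z_def)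
  with x show ?thesis using that by blast
qed

theorem symmetric_orthonormal_eigenbasis:
  assumes sym: "\<And>i j. i < n \<Longrightarrow> j < n \<Longrightarrow> A i j = A j i"
  obtains u l where "orthonormal_family n n u"
    "\<And>a i. a < n \<Longrightarrow> i < n \<Longrightarrow> mat_app n A (u a) i = l a * u a i"
proof -
  have "\<exists>u l. orthonormal_family n k u \<and>
      (\<forall>a i. a < k \<longrightarrow> i < n \<longrightarrow> mat_app n A (u a) i = l a * u a i)" if "k \<le> n" for k
    using that
  proof (induction k)
    case 0
    then show ?case by (simp add: orthonormal_family_def)
  next
    case (Suc k)
    then obtain u l where u: "orthonormal_family n k u"
      and eig: "\<And>a i. a < k \<Longrightarrow> i < n \<Longrightarrow> mat_app n A (u a) i = l a * u a i" by auto
    have "k < n" using Suc by simp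
    obtain x m where x: "dot n x x = 1" "\<And>a. a < k \<Longrightarrow> dot n (u a) x = 0"
      "\<And>i. i < n \<Longrightarrow> mat_app n A x i = m * x i"
      using next_eigenvector[where A = A and l = l, OF sym u \<open>k < n\<close> eig] by metis
    have "orthonormal_family n (Suc k) (u(k := x))"
      using u x by (auto simp: orthonormal_family_def less_Suc_eq dot_commute[of n x "u _"])
    moreover have "\<forall>a i. a < Suc k \<longrightarrow> i < n \<longrightarrow>
        mat_app n A ((u(k := x)) a) i = (l(k := m)) a * (u(k := x)) a i"
      using eig x by (auto simp: less_Suc_eq)
    ultimately show ?case by blast
  qed
  from this[OF order_refl] that show ?thesis by blast
qed

section \<open>Random signs and Bernoulli products\<close>

text \<open>Signs are real numbers because they serve as coefficients; extensionality outside
  \<open>{..<n}\<close> makes the cube finite.\<close>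

definition signs :: "nat \<Rightarrow> (nat \<Rightarrow> real) set" where
  "signs n = Pi\<^sub>E {..<n} (\<lambda>_. {-1, 1})"

lemma finite_signs: "finite (signs n)"
  by (auto simp: signs_def intro!: finite_PiE)

lemma card_signs: "card (signs n) = 2 ^ n"
  by (simp add: signs_def card_PiE numeral_2_eq_2)

lemma signs_cases: "\<epsilon> \<in> signs n \<Longrightarrow> k < n \<Longrightarrow> \<epsilon> k = 1 \<or> \<epsilon> k = -1"
  by (auto simp: signs_def)

lemma flip_in_signs: "\<epsilon> \<in> signs n \<Longrightarrow> k < n \<Longrightarrow> \<epsilon>(k := - \<epsilon> k) \<in> signs n"
  using signs_cases[of \<epsilon> n k] by (auto simp: signs_def PiE_iff extensional_def)

lemma sum_signs_flip:
  assumes "k < n"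
  shows "(\<Sum>\<epsilon>\<in>signs n. f (\<epsilon>(k := - \<epsilon> k))) = (\<Sum>\<epsilon>\<in>signs n. f \<epsilon>)"
  by (rule sum.reindex_bij_witness[where i = "\<lambda>\<epsilon>. \<epsilon>(k := - \<epsilon> k)" and j = "\<lambda>\<epsilon>. \<epsilon>(k := - \<epsilon> k)"])
     (use assms in \<open>auto simp: flip_in_signs\<close>)

section \<open>Sub-Gaussian tails of Rademacher sums\<close>

lemma two_power_times_fact_le: "2 ^ k * fact k \<le> (fact (2 * k) :: real)"
proof (induction k)
  case (Suc k)
  have "2 ^ Suc k * fact (Suc k) = (2 * real (Suc k)) * (2 ^ k * fact k :: real)"
    by simp
  also have "\<dots> \<le> (2 * real (Suc k)) * fact (2 * k)"
    using Suc by (intro mult_left_mono) auto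
  also have "\<dots> \<le> (2 * real (Suc k)) * (real (Suc (2 * k)) * fact (2 * k))"
    by (intro mult_left_mono) (simp_all add: mult_le_cancel_right1)
  also have "\<dots> = fact (2 * Suc k)"
    by (simp add: algebra_simps)
  finally show ?case .
qed simp

text \<open>The power series are compared term by term: \<open>fact (2 * k)\<close> dominates
  \<open>2 ^ k * fact k\<close>, the product of the even numbers up to \<open>2 * k\<close>.\<close>

lemma cosh_le_exp_half_square: "cosh x \<le> exp (x\<^sup>2 / 2)" for x :: real
proof (rule sums_le)
  have "(\<lambda>n. if even n then x ^ n /\<^sub>R fact n else 0) sums cosh x"
    by (rule cosh_converges)
  \<comment> \<open>The odd terms vanish, so the series may be summed along the even indices
    alone.\<close>
  then have "(\<lambda>k. if even (2 * k) then x ^ (2 * k) /\<^sub>R fact (2 * k) else 0) sums cosh x"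
    by (subst sums_mono_reindex) (auto simp: strict_mono_def elim!: evenE)
  then show "(\<lambda>k. x ^ (2 * k) / fact (2 * k)) sums cosh x"
    by (simp add: divide_inverse mult.commute)
  show "(\<lambda>k. (x\<^sup>2 / 2) ^ k /\<^sub>R fact k) sums exp (x\<^sup>2 / 2)"
    by (rule exp_converges)
  show "x ^ (2 * k) / fact (2 * k) \<le> (x\<^sup>2 / 2) ^ k /\<^sub>R fact k" for k
  proof -
    have "x ^ (2 * k) / fact (2 * k) \<le> x ^ (2 * k) / (2 ^ k * fact k)"
      using two_power_times_fact_le[of k] by (intro divide_left_mono) (auto simp: power_mult)
    also have "\<dots> = (x\<^sup>2 / 2) ^ k /\<^sub>R fact k"
      unfolding power_mult power_divide real_scaleR_def by (simp add: divide_simps)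
    finally show ?thesis .
  qed
qed

text \<open>Up to the factor \<open>2 ^ n\<close> this is the moment generating function of a
  Rademacher sum, which factorises over the coordinates into hyperbolic cosines.\<close>

lemma sum_signs_exp_le:
  "(\<Sum>\<epsilon>\<in>signs n. exp (\<Sum>k<n. \<epsilon> k * c k)) \<le> 2 ^ n * exp ((\<Sum>k<n. (c k)\<^sup>2) / 2)"
proof -
  have "(\<Sum>\<epsilon>\<in>signs n. exp (\<Sum>k<n. \<epsilon> k * c k)) = (\<Prod>k<n. \<Sum>s\<in>{-1, 1}. exp (s * c k))"
    unfolding signs_def by (subst prod_sum_PiE) (auto simp: exp_sum)
  also have "\<dots> = (\<Prod>k<n. 2 * cosh (c k))"
    by (intro prod.cong) (auto simp: cosh_field_def)
  also have "\<dots> \<le> (\<Prod>k<n. 2 * exp ((c k)\<^sup>2 / 2))"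
    by (intro prod_mono) (auto simp: cosh_le_exp_half_square)
  also have "\<dots> = 2 ^ n * exp ((\<Sum>k<n. (c k)\<^sup>2) / 2)"
    by (simp add: prod.distrib exp_sum sum_divide_distrib)
  finally show ?thesis .
qed

text \<open>Chernoff's method: exponential Markov inequality for the uniform law on the
  cube.\<close>

lemma card_signs_upper_tail:
  assumes "t > 0" "L \<ge> 0" "4 * L * (\<Sum>k<n. (c k)\<^sup>2) \<le> t\<^sup>2"
  shows "real (card {\<epsilon> \<in> signs n. t < (\<Sum>k<n. \<epsilon> k * c k)}) \<le> 2 ^ n * exp (- 2 * L)"
proof -
  \<comment> \<open>With \<open>V\<close> the sum of the squares of \<open>c\<close>, the exponent
    \<open>a\<^sup>2 * V / 2 - a * t\<close> is least at \<open>a = t / V\<close>. This is that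
    value in the extremal case \<open>4 * L * V = t\<^sup>2\<close>, and it also makes sense for
    \<open>V = 0\<close>.\<close>
  define a where "a = 4 * L / t"
  define E where "E = {\<epsilon> \<in> signs n. t < (\<Sum>k<n. \<epsilon> k * c k)}"
  have "a \<ge> 0" using assms by (simp add: a_def)
  have "real (card E) * exp (a * t) = (\<Sum>\<epsilon>\<in>E. exp (a * t))"
    by simp
  also have "\<dots> \<le> (\<Sum>\<epsilon>\<in>E. exp (a * (\<Sum>k<n. \<epsilon> k * c k)))"
    using \<open>a \<ge> 0\<close> by (intro sum_mono) (auto simp: E_def intro!: mult_left_mono)
  also have "\<dots> \<le> (\<Sum>\<epsilon>\<in>signs n. exp (a * (\<Sum>k<n. \<epsilon> k * c k)))"
    by (intro sum_mono2 finite_signs) (auto simp: E_def)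
  also have "\<dots> = (\<Sum>\<epsilon>\<in>signs n. exp (\<Sum>k<n. \<epsilon> k * (a * c k)))"
    by (simp add: sum_distrib_left mult_ac)
  also have "\<dots> \<le> 2 ^ n * exp ((\<Sum>k<n. (a * c k)\<^sup>2) / 2)"
    by (rule sum_signs_exp_le)
  finally have "real (card E) \<le> 2 ^ n * exp ((\<Sum>k<n. (a * c k)\<^sup>2) / 2) / exp (a * t)"
    by (simp add: pos_le_divide_eq)
  also have "\<dots> = 2 ^ n * exp ((\<Sum>k<n. (a * c k)\<^sup>2) / 2 - a * t)"
    by (simp add: exp_diff)
  also have "(\<Sum>k<n. (a * c k)\<^sup>2) / 2 - a * t \<le> - 2 * L"
  proof -
    have "(\<Sum>k<n. (a * c k)\<^sup>2) / 2 = (2 * L / t\<^sup>2) * (4 * L * (\<Sum>k<n. (c k)\<^sup>2))"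
      unfolding power_mult_distrib sum_distrib_left[symmetric]
      by (simp add: a_def power_divide power2_eq_square)
    also have "\<dots> \<le> (2 * L / t\<^sup>2) * t\<^sup>2"
      using assms by (intro mult_left_mono) auto
    also have "\<dots> = 2 * L" using assms by simp
    finally show ?thesis using assms by (simp add: a_def)
  qed
  finally show ?thesis by (simp add: E_def)
qed

lemma card_signs_tail:
  assumes "t > 0" "L \<ge> 0" "4 * L * (\<Sum>k<n. (c k)\<^sup>2) \<le> t\<^sup>2"
  shows "real (card {\<epsilon> \<in> signs n. t < \<bar>\<Sum>k<n. \<epsilon> k * c k\<bar>}) \<le> 2 ^ n * (2 * exp (- 2 * L))"
proof -
  let ?E = "\<lambda>c. {\<epsilon> \<in> signs n. t < (\<Sum>k<n. \<epsilon> k * c k)}"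
  have split: "{\<epsilon> \<in> signs n. t < \<bar>\<Sum>k<n. \<epsilon> k * c k\<bar>} = ?E c \<union> ?E (\<lambda>k. - c k)"
    by (auto simp: sum_negf abs_if)
  have "card {\<epsilon> \<in> signs n. t < \<bar>\<Sum>k<n. \<epsilon> k * c k\<bar>} \<le> card (?E c) + card (?E (\<lambda>k. - c k))"
    unfolding split by (rule card_Un_le)
  moreover have "real (card (?E c)) \<le> 2 ^ n * exp (- 2 * L)"
    using assms by (rule card_signs_upper_tail)
  moreover have "real (card (?E (\<lambda>k. - c k))) \<le> 2 ^ n * exp (- 2 * L)"
    using assms by (intro card_signs_upper_tail) auto
  ultimately show ?thesis by simp
qed

section \<open>From affinity to testing error to estimation error on the cube\<close>

lemma sum_min_ge_half:
  fixes p q :: "'y \<Rightarrow> real"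
  assumes "\<And>y. y \<in> Y \<Longrightarrow> p y \<ge> 0" "\<And>y. y \<in> Y \<Longrightarrow> q y \<ge> 0"
    and "sum p Y = 1" "sum q Y = 1"
    and bc: "(\<Sum>y\<in>Y. sqrt (p y * q y))\<^sup>2 \<ge> 3 / 4"
  shows "(\<Sum>y\<in>Y. min (p y) (q y)) \<ge> 1 / 2"
proof -
  define m where "m = (\<Sum>y\<in>Y. min (p y) (q y))"
  \<comment> \<open>A product equals minimum times maximum, and the minima and maxima together sum
    to \<open>2\<close>. Cauchy-Schwarz then bounds the squared affinity by
    \<open>m * (2 - m) = 1 - (1 - m)\<^sup>2\<close>.\<close>
  have "(\<Sum>y\<in>Y. sqrt (p y * q y)) = (\<Sum>y\<in>Y. sqrt (min (p y) (q y)) * sqrt (max (p y) (q y)))"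
    by (intro sum.cong) (auto simp: min_def max_def real_sqrt_mult)
  then have "3 / 4 \<le> (\<Sum>y\<in>Y. sqrt (min (p y) (q y)) * sqrt (max (p y) (q y)))\<^sup>2"
    using bc by simp
  also have "\<dots> \<le> (\<Sum>y\<in>Y. (sqrt (min (p y) (q y)))\<^sup>2) * (\<Sum>y\<in>Y. (sqrt (max (p y) (q y)))\<^sup>2)"
    by (rule Cauchy_Schwarz_ineq_sum)
  also have "(\<Sum>y\<in>Y. (sqrt (min (p y) (q y)))\<^sup>2) = m"
    unfolding m_def using assms by (intro sum.cong) auto
  also have "(\<Sum>y\<in>Y. (sqrt (max (p y) (q y)))\<^sup>2) = (\<Sum>y\<in>Y. p y + q y - min (p y) (q y))"
    using assms by (intro sum.cong) (auto simp: max_def min_def)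
  also have "\<dots> = 2 - m"
    using assms by (simp add: m_def sum_subtractf sum.distrib)
  finally have "(1 - m)\<^sup>2 \<le> (1 / 2)\<^sup>2"
    by (simp add: power2_eq_square algebra_simps)
  then have "1 - m \<le> 1 / 2"
    by (rule power2_le_imp_le) simp
  then show ?thesis by (simp add: m_def)
qed

text \<open>Every sign is misjudged with average probability at least \<open>1/4\<close>, hence so is the weighted
  error \<open>D \<in> [0, 1]\<close> in expectation, and \<open>P(D \<ge> 1/16) \<ge> (1/4 - 1/16) / (1 - 1/16) = 1/5\<close>. The sign
  vectors outside \<open>G\<close> cost at most \<open>1/16\<close>, which leaves more than \<open>1/15\<close>.\<close>

lemma assouad_probability:
  fixes p :: "(nat \<Rightarrow> real) \<Rightarrow> 'y \<Rightarrow> real" and h :: "'y \<Rightarrow> nat \<Rightarrow> real" and w :: "nat \<Rightarrow> real"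
  assumes Y: "finite Y"
    and p_nonneg: "\<And>\<epsilon> y. \<epsilon> \<in> signs n \<Longrightarrow> y \<in> Y \<Longrightarrow> p \<epsilon> y \<ge> 0"
    and p_sum: "\<And>\<epsilon>. \<epsilon> \<in> signs n \<Longrightarrow> sum (p \<epsilon>) Y = 1"
    and overlap: "\<And>\<epsilon> k. \<epsilon> \<in> signs n \<Longrightarrow> k < n \<Longrightarrow>
      (\<Sum>y\<in>Y. min (p \<epsilon> y) (p (\<epsilon>(k := - \<epsilon> k)) y)) \<ge> 1 / 2"
    and w_nonneg: "\<And>k. k < n \<Longrightarrow> w k \<ge> 0" and w_sum: "(\<Sum>k<n. w k) = 1"
    and good: "G \<subseteq> signs n" "real (card (signs n - G)) \<le> 2 ^ n / 16"
  shows "\<exists>\<epsilon>\<in>G. (\<Sum>y\<in>{y \<in> Y. 1 / 16 \<le> (\<Sum>k<n. w k * of_bool (h y k \<noteq> \<epsilon> k))}. p \<epsilon> y) \<ge> 1 / 15"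
proof (rule ccontr)
  assume contra: "\<not> ?thesis"
  define D where "D \<epsilon> y = (\<Sum>k<n. w k * of_bool (h y k \<noteq> \<epsilon> k))" for \<epsilon> y
  define P where "P \<epsilon> = (\<Sum>y\<in>{y \<in> Y. 1 / 16 \<le> D \<epsilon> y}. p \<epsilon> y)" for \<epsilon>
  define err where "err k \<epsilon> = (\<Sum>y\<in>Y. p \<epsilon> y * of_bool (h y k \<noteq> \<epsilon> k))" for k \<epsilon>
  have small: "P \<epsilon> \<le> 1 / 15" if "\<epsilon> \<in> G" for \<epsilon>
    using contra that by (auto simp: P_def D_def not_le intro: less_imp_le)
  have D_le: "D \<epsilon> y \<le> 1" for \<epsilon> y
  proof -
    have "D \<epsilon> y \<le> (\<Sum>k<n. w k)"
      unfolding D_def using w_nonneg by (intro sum_mono) (auto simp: of_bool_def)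
    then show ?thesis using w_sum by simp
  qed
  have err_ge: "(\<Sum>\<epsilon>\<in>signs n. err k \<epsilon>) \<ge> 2 ^ n / 4" if k: "k < n" for k
  proof -
    have "1 / 2 \<le> err k \<epsilon> + err k (\<epsilon>(k := - \<epsilon> k))" if e: "\<epsilon> \<in> signs n" for \<epsilon>
    proof -
      \<comment> \<open>The decision \<open>h y k\<close> cannot equal both
        \<open>\<epsilon> k\<close> and \<open>- \<epsilon> k\<close>, so at each \<open>y\<close>
        at least one error term is present.\<close>
      have "min (p \<epsilon> y) (p (\<epsilon>(k := - \<epsilon> k)) y)
          \<le> p \<epsilon> y * of_bool (h y k \<noteq> \<epsilon> k) + p (\<epsilon>(k := - \<epsilon> k)) y * of_bool (h y k \<noteq> - \<epsilon> k)"
        if "y \<in> Y" for y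
        using signs_cases[OF e k] p_nonneg[OF e that] p_nonneg[OF flip_in_signs[OF e k] that]
        by (auto simp: of_bool_def)
      then have "(\<Sum>y\<in>Y. min (p \<epsilon> y) (p (\<epsilon>(k := - \<epsilon> k)) y)) \<le> err k \<epsilon> + err k (\<epsilon>(k := - \<epsilon> k))"
        unfolding err_def sum.distrib[symmetric] by (intro sum_mono) auto
      then show ?thesis using overlap[OF e k] by linarith
    qed
    then have "(\<Sum>\<epsilon>\<in>signs n. 1 / 2) \<le> (\<Sum>\<epsilon>\<in>signs n. err k \<epsilon> + err k (\<epsilon>(k := - \<epsilon> k)))"
      by (rule sum_mono)
    also have "\<dots> = 2 * (\<Sum>\<epsilon>\<in>signs n. err k \<epsilon>)"
      using sum_signs_flip[OF k, of "err k"] by (simp add: sum.distrib)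
    finally show ?thesis by (simp add: card_signs)
  qed
  have "(\<Sum>\<epsilon>\<in>signs n. \<Sum>y\<in>Y. p \<epsilon> y * D \<epsilon> y) = (\<Sum>\<epsilon>\<in>signs n. \<Sum>k<n. w k * err k \<epsilon>)"
  proof (intro sum.cong refl)
    fix \<epsilon>
    have "(\<Sum>y\<in>Y. p \<epsilon> y * D \<epsilon> y) = (\<Sum>y\<in>Y. \<Sum>k<n. w k * (p \<epsilon> y * of_bool (h y k \<noteq> \<epsilon> k)))"
      unfolding D_def sum_distrib_left by (intro sum.cong refl) (simp only: mult_ac)
    also have "\<dots> = (\<Sum>k<n. \<Sum>y\<in>Y. w k * (p \<epsilon> y * of_bool (h y k \<noteq> \<epsilon> k)))"
      by (rule sum.swap)
    also have "\<dots> = (\<Sum>k<n. w k * err k \<epsilon>)"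
      by (simp only: err_def sum_distrib_left)
    finally show "(\<Sum>y\<in>Y. p \<epsilon> y * D \<epsilon> y) = (\<Sum>k<n. w k * err k \<epsilon>)" .
  qed
  also have "\<dots> = (\<Sum>k<n. \<Sum>\<epsilon>\<in>signs n. w k * err k \<epsilon>)"
    by (rule sum.swap)
  also have "\<dots> \<ge> (\<Sum>k<n. w k * (2 ^ n / 4))"
    using err_ge w_nonneg
    unfolding sum_distrib_left[symmetric] by (intro sum_mono mult_left_mono) auto
  also have "(\<Sum>k<n. w k * (2 ^ n / 4)) = 2 ^ n / 4"
    by (simp only: sum_distrib_right[symmetric] w_sum)
  finally have lower: "2 ^ n / 4 \<le> (\<Sum>\<epsilon>\<in>signs n. \<Sum>y\<in>Y. p \<epsilon> y * D \<epsilon> y)" .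
  have "(\<Sum>y\<in>Y. p \<epsilon> y * D \<epsilon> y) \<le> 1 / 16 + 15 / 16 * P \<epsilon>" if e: "\<epsilon> \<in> signs n" for \<epsilon>
  proof -
    \<comment> \<open>\<open>D\<close> is below \<open>1/16\<close> off the event and at most
      \<open>1 = 1/16 + 15/16\<close> on it.\<close>
    have "(\<Sum>y\<in>Y. p \<epsilon> y * D \<epsilon> y) \<le> (\<Sum>y\<in>Y. p \<epsilon> y * (1 / 16 + 15 / 16 * of_bool (1 / 16 \<le> D \<epsilon> y)))"
      using p_nonneg[OF e] D_le by (intro sum_mono mult_left_mono) (auto simp: of_bool_def)
    also have "\<dots> = 1 / 16 * (\<Sum>y\<in>Y. p \<epsilon> y) + 15 / 16 * (\<Sum>y\<in>Y. p \<epsilon> y * of_bool (1 / 16 \<le> D \<epsilon> y))"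
      unfolding sum_distrib_left sum.distrib[symmetric]
      by (intro sum.cong refl) (simp only: distrib_left mult_ac)
    also have "(\<Sum>y\<in>Y. p \<epsilon> y * of_bool (1 / 16 \<le> D \<epsilon> y)) = P \<epsilon>"
      unfolding P_def by (simp add: sum.inter_filter[OF Y] of_bool_def if_distrib cong: if_cong)
    finally show ?thesis using p_sum[OF e] by simp
  qed
  then have "(\<Sum>\<epsilon>\<in>signs n. \<Sum>y\<in>Y. p \<epsilon> y * D \<epsilon> y) \<le> (\<Sum>\<epsilon>\<in>signs n. 1 / 16 + 15 / 16 * P \<epsilon>)"
    by (rule sum_mono)
  also have "\<dots> = 2 ^ n / 16 + 15 / 16 * (\<Sum>\<epsilon>\<in>signs n. P \<epsilon>)"
    by (simp add: sum.distrib sum_distrib_left card_signs)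
  finally have P_ge: "2 ^ n / 4 \<le> 2 ^ n / 16 + 15 / 16 * (\<Sum>\<epsilon>\<in>signs n. P \<epsilon>)"
    using lower by linarith
  have P_le: "P \<epsilon> \<le> 1" if e: "\<epsilon> \<in> signs n" for \<epsilon>
  proof -
    have "P \<epsilon> \<le> sum (p \<epsilon>) Y"
      unfolding P_def using Y p_nonneg[OF e] by (intro sum_mono2) auto
    then show ?thesis using p_sum[OF e] by simp
  qed
  have "(\<Sum>\<epsilon>\<in>signs n. P \<epsilon>) = (\<Sum>\<epsilon>\<in>signs n - G. P \<epsilon>) + (\<Sum>\<epsilon>\<in>G. P \<epsilon>)"
    using good finite_signs by (intro sum.subset_diff)
  also have "(\<Sum>\<epsilon>\<in>signs n - G. P \<epsilon>) \<le> (\<Sum>\<epsilon>\<in>signs n - G. 1)"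
    using P_le by (intro sum_mono) auto
  also have "(\<Sum>\<epsilon>\<in>G. P \<epsilon>) \<le> (\<Sum>\<epsilon>\<in>G. 1 / 15)"
    using small by (intro sum_mono) auto
  finally have "(\<Sum>\<epsilon>\<in>signs n. P \<epsilon>) \<le> real (card (signs n - G)) + real (card G) / 15"
    by simp
  also have "\<dots> \<le> 2 ^ n / 16 + 2 ^ n / 15"
  proof -
    have "card G \<le> 2 ^ n"
      using card_mono[OF finite_signs good(1)] by (simp add: card_signs)
    then have "real (card G) \<le> 2 ^ n"
      by (metis of_nat_le_iff of_nat_numeral of_nat_power)
    then show ?thesis using good(2) by linarith
  qed
  \<comment> \<open>The average of \<open>P\<close> over the cube is at least
    \<open>1/5 = 48/240\<close> by \<open>P_ge\<close>, yet at most
    \<open>1/16 + 1/15 = 31/240\<close>.\<close>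
  finally show False
    using P_ge zero_less_power[of "2::real" n] by linarith
qed

section \<open>Hellinger affinity of logistic Bernoulli laws and their products\<close>

lemma logistic_eq_cosh:
  "1 / (1 + exp (- x)) = exp (x / 2) / (2 * cosh (x / 2))" for x :: real
proof -
  have "exp (x / 2) * (1 + exp (- x)) = 2 * cosh (x / 2)"
    by (simp add: cosh_field_def distrib_left exp_add[symmetric])
  moreover have "1 + exp (- x) > 0"
    by (simp add: add_pos_pos)
  ultimately show ?thesis
    by (simp add: frac_eq_eq less_imp_neq[symmetric])
qed

lemma logistic_complement: "1 - 1 / (1 + exp (- x)) = 1 / (1 + exp x)" for x :: real
proof -
  have "1 + exp x > 0"
    by (simp add: add_pos_pos)
  then show ?thesis
    by (simp add: exp_minus field_simps)
qed

lemma cosh_mult_le: "cosh (x + y) * cosh (x - y) \<le> (cosh x * cosh y)\<^sup>2" for x y :: real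
proof -
  have "cosh (x + y) * cosh (x - y) = (cosh x * cosh y)\<^sup>2 - (sinh x * sinh y)\<^sup>2"
    by (simp add: cosh_add cosh_diff algebra_simps power2_eq_square)
  then show ?thesis by simp
qed

text \<open>With \<open>x = (a + b)/4\<close> and \<open>y = (a - b)/4\<close> the squared affinity is
  \<open>cosh\<^sup>2 x / (cosh (x + y) cosh (x - y)) \<ge> 1 / cosh\<^sup>2 y\<close>.\<close>

lemma logistic_bhattacharyya:
  fixes a b :: real
  shows "exp (- ((a - b)\<^sup>2 / 16)) \<le>
    (sqrt (1 / (1 + exp (- a)) * (1 / (1 + exp (- b)))) +
     sqrt ((1 - 1 / (1 + exp (- a))) * (1 - 1 / (1 + exp (- b)))))\<^sup>2"
proof -
  define x y where "x = (a + b) / 4" and "y = (a - b) / 4"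
  have ab: "a / 2 = x + y" "b / 2 = x - y" by (auto simp: x_def y_def field_simps)
  define C where "C = cosh (a / 2) * cosh (b / 2)"
  have "C > 0" by (simp add: C_def)
  have 1: "sqrt (1 / (1 + exp (- a)) * (1 / (1 + exp (- b)))) = exp x / (2 * sqrt C)"
  proof -
    have "1 / (1 + exp (- a)) * (1 / (1 + exp (- b))) = (exp x)\<^sup>2 / (2\<^sup>2 * C)"
      by (simp add: logistic_eq_cosh C_def exp_add[symmetric] exp_double[symmetric] ab)
    then show ?thesis
      by (simp only: real_sqrt_divide real_sqrt_mult) simp
  qed
  have 2: "sqrt ((1 - 1 / (1 + exp (- a))) * (1 - 1 / (1 + exp (- b)))) = exp (- x) / (2 * sqrt C)"
  proof -
    have "(1 - 1 / (1 + exp (- a))) * (1 - 1 / (1 + exp (- b))) = (exp (- x))\<^sup>2 / (2\<^sup>2 * C)"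
    proof -
      have "1 / (1 + exp a) = exp (- (a / 2)) / (2 * cosh (a / 2))"
        "1 / (1 + exp b) = exp (- (b / 2)) / (2 * cosh (b / 2))"
        using logistic_eq_cosh[of "- a"] logistic_eq_cosh[of "- b"] by simp_all
      then show ?thesis
        unfolding logistic_complement by (simp add: C_def exp_add[symmetric] exp_double[symmetric] ab)
    qed
    then show ?thesis
      by (simp only: real_sqrt_divide real_sqrt_mult) simp
  qed
  \<comment> \<open>The constant \<open>16\<close> comes from
    \<open>y\<^sup>2 = (a - b)\<^sup>2 / 16\<close>; the next step bounds \<open>cosh y\<close> by
    \<open>exp (y\<^sup>2 / 2)\<close>, as for the Rademacher sums.\<close>
  have "exp (- ((a - b)\<^sup>2 / 16)) = 1 / (exp (y\<^sup>2 / 2))\<^sup>2"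
    by (simp add: y_def power_divide exp_double[symmetric] exp_minus inverse_eq_divide)
  also have "\<dots> \<le> 1 / (cosh y)\<^sup>2"
    using cosh_le_exp_half_square[of y] by (intro divide_left_mono power_mono) auto
  also have "\<dots> = (cosh x)\<^sup>2 / (cosh x * cosh y)\<^sup>2"
    by (simp add: power_mult_distrib)
  also have "\<dots> \<le> (cosh x)\<^sup>2 / C"
    using cosh_mult_le[of x y] \<open>C > 0\<close> by (intro divide_left_mono) (auto simp: C_def ab)
  also have "\<dots> = (exp x / (2 * sqrt C) + exp (- x) / (2 * sqrt C))\<^sup>2"
    using \<open>C > 0\<close> by (simp add: cosh_field_def add_divide_distrib[symmetric] power_divide power_mult_distrib)
  finally show ?thesis by (simp only: 1 2)
qed

lemma sqrt_prod: "sqrt (\<Prod>i\<in>I. f i) = (\<Prod>i\<in>I. sqrt (f i))"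
  by (induction I rule: infinite_finite_induct) (simp_all add: real_sqrt_mult)

text \<open>Changing the value outside \<open>I\<close> maps functions with default \<open>d\<close>
  bijectively to extensional ones. The product does not see this value, so the distributive law for
  \<open>Pi\<^sub>E\<close> carries over.\<close>

lemma sum_PiE_dflt_prod:
  fixes f :: "'i \<Rightarrow> 'b :: finite \<Rightarrow> real"
  assumes "finite I"
  shows "(\<Sum>y\<in>PiE_dflt I d (\<lambda>_. UNIV). \<Prod>i\<in>I. f i (y i)) = (\<Prod>i\<in>I. \<Sum>b\<in>UNIV. f i b)"
proof -
  have "(\<Prod>i\<in>I. \<Sum>b\<in>UNIV. f i b) = (\<Sum>y\<in>Pi\<^sub>E I (\<lambda>_. UNIV). \<Prod>i\<in>I. f i (y i))"
    using assms by (intro prod_sum_PiE) auto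
  also have "\<dots> = (\<Sum>y\<in>PiE_dflt I d (\<lambda>_. UNIV). \<Prod>i\<in>I. f i (y i))"
    by (rule sum.reindex_bij_witness[where j = "\<lambda>g i. if i \<in> I then g i else d" and
          i = "\<lambda>g. restrict g I"])
       (auto simp: PiE_dflt_def PiE_def extensional_def fun_eq_iff intro!: prod.cong)
  finally show ?thesis by simp
qed

text \<open>The affinity of product laws is the product of the affinities of the factors, so the
  exponents of the single-coordinate bounds add up.\<close>

lemma Pi_bernoulli_bhattacharyya:
  fixes a b :: "'i \<Rightarrow> real" and I :: "'i set"
  defines "P \<equiv> \<lambda>a. Pi_pmf I False (\<lambda>i. bernoulli_pmf (1 / (1 + exp (- a i))))"
  assumes "finite I"
  shows "exp (- ((\<Sum>i\<in>I. (a i - b i)\<^sup>2) / 16)) \<le>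
    (\<Sum>y\<in>PiE_dflt I False (\<lambda>_. UNIV). sqrt (pmf (P a) y * pmf (P b) y))\<^sup>2"
proof -
  have range: "0 \<le> 1 / (1 + exp (- x))" "1 / (1 + exp (- x)) \<le> 1" for x :: real
    by (simp_all add: add_pos_pos)
  define B where "B x = bernoulli_pmf (1 / (1 + exp (- x)))" for x :: real
  have "(\<Sum>y\<in>PiE_dflt I False (\<lambda>_. UNIV). sqrt (pmf (P a) y * pmf (P b) y))
      = (\<Sum>y\<in>PiE_dflt I False (\<lambda>_. UNIV). \<Prod>i\<in>I. sqrt (pmf (B (a i)) (y i) * pmf (B (b i)) (y i)))"
  proof (intro sum.cong refl)
    fix y :: "'i \<Rightarrow> bool" assume "y \<in> PiE_dflt I False (\<lambda>_. UNIV)"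
    then have "pmf (P c) y = (\<Prod>i\<in>I. pmf (B (c i)) (y i))" for c
      unfolding P_def B_def using \<open>finite I\<close> by (intro pmf_Pi') (auto simp: PiE_dflt_def)
    then have "sqrt (pmf (P a) y * pmf (P b) y)
        = sqrt (\<Prod>i\<in>I. pmf (B (a i)) (y i) * pmf (B (b i)) (y i))"
      by (simp only: prod.distrib)
    then show "sqrt (pmf (P a) y * pmf (P b) y)
        = (\<Prod>i\<in>I. sqrt (pmf (B (a i)) (y i) * pmf (B (b i)) (y i)))"
      by (simp only: sqrt_prod)
  qed
  also have "\<dots> = (\<Prod>i\<in>I. \<Sum>c\<in>UNIV. sqrt (pmf (B (a i)) c * pmf (B (b i)) c))"
    using \<open>finite I\<close> by (rule sum_PiE_dflt_prod)
  finally have eq: "(\<Sum>y\<in>PiE_dflt I False (\<lambda>_. UNIV). sqrt (pmf (P a) y * pmf (P b) y))\<^sup>2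
      = (\<Prod>i\<in>I. (\<Sum>c\<in>UNIV. sqrt (pmf (B (a i)) c * pmf (B (b i)) c))\<^sup>2)"
    by (simp add: prod_power_distrib)
  have "exp (- ((\<Sum>i\<in>I. (a i - b i)\<^sup>2) / 16)) = (\<Prod>i\<in>I. exp (- ((a i - b i)\<^sup>2 / 16)))"
    using \<open>finite I\<close> by (simp add: exp_sum[symmetric] sum_negf sum_divide_distrib)
  also have "\<dots> \<le> (\<Prod>i\<in>I. (\<Sum>c\<in>UNIV. sqrt (pmf (B (a i)) c * pmf (B (b i)) c))\<^sup>2)"
  proof (intro prod_mono conjI)
    fix i
    show "exp (- ((a i - b i)\<^sup>2 / 16)) \<le> (\<Sum>c\<in>UNIV. sqrt (pmf (B (a i)) c * pmf (B (b i)) c))\<^sup>2"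
      using logistic_bhattacharyya[of "a i" "b i"] range[of "a i"] range[of "b i"]
      by (simp add: B_def UNIV_bool add.commute)
  qed simp
  finally show ?thesis by (simp only: eq)
qed

section \<open>The lower bound\<close>

lemma dot_vec_index: "y \<in> carrier_vec n \<Longrightarrow> dot n (vec_index x) (vec_index y) = x \<bullet> y"
  by (simp add: dot_def scalar_prod_def atLeast0LessThan)

lemma mat_app_mat_index:
  assumes "W \<in> carrier_mat n n" "x \<in> carrier_vec n" "i < n"
  shows "mat_app n (\<lambda>i j. W $$ (i, j)) (vec_index x) i = (W *\<^sub>v x) $ i"
  using assms by (auto simp: mat_app_def scalar_prod_def atLeast0LessThan intro!: sum.cong)

text \<open>A right inverse of a square matrix over a field is also a left inverse, and this
  determines what \<open>mat_inverse\<close> returns.\<close>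

lemma mat_inverse_eqI:
  fixes W X :: "'a :: field mat"
  assumes W: "W \<in> carrier_mat n n" and X: "X \<in> carrier_mat n n" and WX: "W * X = 1\<^sub>m n"
  shows "the (mat_inverse W) = X"
proof -
  have "X * W = 1\<^sub>m n"
    using W X WX by (rule mat_mult_left_right_inverse)
  then have "W \<in> Units (ring_mat TYPE('a) n ())"
    using W X WX by (auto simp: Units_def ring_mat_def)
  then obtain Y where Y: "mat_inverse W = Some Y"
    using mat_inverse(1)[OF W, of "()"] by (cases "mat_inverse W") auto
  from mat_inverse(2)[OF W Y] have YW: "Y * W = 1\<^sub>m n" and Yc: "Y \<in> carrier_mat n n"
    by auto
  have "Y = Y * (W * X)"
    using Yc by (simp add: WX)
  also have "\<dots> = X"
    using Yc W X YW by (simp add: assoc_mult_mat[symmetric])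
  finally show ?thesis by (simp add: Y)
qed

lemma sum_of_bool_eq: "finite A \<Longrightarrow> i \<in> A \<Longrightarrow> (\<Sum>j\<in>A. f j * of_bool (i = j)) = (f i :: real)"
  by (simp add: of_bool_def if_distrib[of "\<lambda>c. _ * c"] cong: if_cong)

lemma pos_def_mat_spectral:
  assumes W: "W \<in> carrier_mat n n" and pd: "pos_def_mat W"
  obtains u l where "orthonormal_family n n u" "\<And>a. a < n \<Longrightarrow> l a > 0"
    "\<And>a. a < n \<Longrightarrow> dot n (u a) (mat_app n (\<lambda>i j. W $$ (i, j)) (u a)) = l a"
    "mat_trace (the (mat_inverse W)) = (\<Sum>a<n. 1 / l a)"
    "\<And>x. x \<in> carrier_vec n \<Longrightarrow>
      x \<bullet> (the (mat_inverse W) *\<^sub>v x) = (\<Sum>a<n. (dot n (u a) (vec_index x))\<^sup>2 / l a)"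
proof -
  have sym: "W $$ (i, j) = W $$ (j, i)" if "i < n" "j < n" for i j
    using pd W that unfolding pos_def_mat_def
    by (metis carrier_matD index_transpose_mat(1))
  obtain u l where on: "orthonormal_family n n u"
    and eig: "\<And>a i. a < n \<Longrightarrow> i < n \<Longrightarrow> mat_app n (\<lambda>i j. W $$ (i, j)) (u a) i = l a * u a i"
    using symmetric_orthonormal_eigenbasis[of n "\<lambda>i j. W $$ (i, j)"] sym by metis
  have quad: "dot n (u a) (mat_app n (\<lambda>i j. W $$ (i, j)) (u a)) = l a" if a: "a < n" for a
  proof -
    have "dot n (u a) (mat_app n (\<lambda>i j. W $$ (i, j)) (u a)) = dot n (u a) (\<lambda>i. l a * u a i)"
      using eig[OF a] by (intro dot_cong) auto
    also have "\<dots> = l a"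
      using on a by (simp add: dot_scale_right orthonormal_family_def)
    finally show ?thesis .
  qed
  have pos: "l a > 0" if a: "a < n" for a
  proof -
    define x where "x = Matrix.vec n (u a)"
    have x: "x \<in> carrier_vec n" "\<And>i. i < n \<Longrightarrow> x $ i = u a i"
      by (simp_all add: x_def)
    have "dot n (u a) (u a) = 1"
      using on a by (simp add: orthonormal_family_def)
    then have "x \<noteq> 0\<^sub>v n"
      using x(2) by (auto simp: dot_def)
    then have "0 < x \<bullet> (W *\<^sub>v x)"
      using pd W x by (auto simp: pos_def_mat_def)
    also have "x \<bullet> (W *\<^sub>v x) = dot n (vec_index x) (vec_index (W *\<^sub>v x))"
      using mult_mat_vec_carrier[OF W x(1)] by (simp add: dot_vec_index)
    also have "\<dots> = dot n (u a) (mat_app n (\<lambda>i j. W $$ (i, j)) (u a))"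
    proof (rule dot_cong)
      fix i assume "i < n"
      have "mat_app n (\<lambda>i j. W $$ (i, j)) (u a) = mat_app n (\<lambda>i j. W $$ (i, j)) (vec_index x)"
        using x by (intro mat_app_cong) simp
      then show "(W *\<^sub>v x) $ i = mat_app n (\<lambda>i j. W $$ (i, j)) (u a) i"
        using mat_app_mat_index[OF W x(1) \<open>i < n\<close>] by simp
    qed (use x in auto)
    finally show ?thesis using quad[OF a] by simp
  qed
  \<comment> \<open>The inverse has the same eigenvectors and reciprocal eigenvalues; its trace and
    quadratic form are read off from this expansion.\<close>
  define X where "X = Matrix.mat n n (\<lambda>(i, j). \<Sum>a<n. u a i * u a j / l a)"
  have Xc: "X \<in> carrier_mat n n" by (simp add: X_def)
  have "W * X = 1\<^sub>m n"
  proof (rule eq_matI)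
    fix i j assume "i < dim_row (1\<^sub>m n :: real mat)" "j < dim_col (1\<^sub>m n :: real mat)"
    then have ij: "i < n" "j < n" by auto
    have "(W * X) $$ (i, j) = (\<Sum>k<n. W $$ (i, k) * (\<Sum>a<n. u a k * u a j / l a))"
      using W ij by (simp add: X_def scalar_prod_def atLeast0LessThan)
    also have "\<dots> = (\<Sum>k<n. \<Sum>a<n. W $$ (i, k) * u a k * (u a j / l a))"
      by (simp add: sum_distrib_left mult_ac)
    also have "\<dots> = (\<Sum>a<n. \<Sum>k<n. W $$ (i, k) * u a k * (u a j / l a))"
      by (rule sum.swap)
    also have "\<dots> = (\<Sum>a<n. mat_app n (\<lambda>i j. W $$ (i, j)) (u a) i * (u a j / l a))"
      by (simp only: mat_app_def sum_distrib_right)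
    also have "\<dots> = (\<Sum>a<n. u a i * u a j)"
      using eig ij pos by (intro sum.cong) (auto simp: less_imp_neq[symmetric])
    also have "\<dots> = 1\<^sub>m n $$ (i, j)"
      using orthonormal_family_complete[OF on ij] ij by simp
    finally show "(W * X) $$ (i, j) = 1\<^sub>m n $$ (i, j)" .
  qed (use W Xc in auto)
  then have inv: "the (mat_inverse W) = X"
    using mat_inverse_eqI[OF W Xc] by blast
  show ?thesis
  proof (rule that[OF on pos quad])
    have "mat_trace X = (\<Sum>i<n. \<Sum>a<n. u a i * u a i / l a)"
      by (simp add: mat_trace_def X_def)
    also have "\<dots> = (\<Sum>a<n. dot n (u a) (u a) / l a)"
      by (subst sum.swap) (simp add: dot_def sum_divide_distrib)
    also have "\<dots> = (\<Sum>a<n. 1 / l a)"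
      using on by (simp add: orthonormal_family_def)
    finally show "mat_trace (the (mat_inverse W)) = (\<Sum>a<n. 1 / l a)"
      by (simp add: inv)
  next
    fix x :: "real Matrix.vec" assume x: "x \<in> carrier_vec n"
    have "x \<bullet> (X *\<^sub>v x) = (\<Sum>i<n. x $ i * (\<Sum>j<n. (\<Sum>a<n. u a i * u a j / l a) * x $ j))"
      using x by (simp add: X_def scalar_prod_def atLeast0LessThan)
    also have "\<dots> = (\<Sum>i<n. \<Sum>j<n. \<Sum>a<n. (u a i * x $ i) * (u a j * x $ j) / l a)"
      by (simp add: sum_distrib_left sum_distrib_right mult_ac)
    also have "\<dots> = (\<Sum>i<n. \<Sum>a<n. \<Sum>j<n. (u a i * x $ i) * (u a j * x $ j) / l a)"
      by (intro sum.cong refl sum.swap)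
    also have "\<dots> = (\<Sum>a<n. \<Sum>i<n. \<Sum>j<n. (u a i * x $ i) * (u a j * x $ j) / l a)"
      by (rule sum.swap)
    also have "\<dots> = (\<Sum>a<n. (dot n (u a) (vec_index x))\<^sup>2 / l a)"
      by (simp add: dot_def power2_eq_square sum_product sum_divide_distrib)
    finally show "x \<bullet> (the (mat_inverse W) *\<^sub>v x) = (\<Sum>a<n. (dot n (u a) (vec_index x))\<^sup>2 / l a)"
      by (simp add: inv)
  qed
qed

section \<open>Consequences of the model assumptions\<close>

context
  fixes M :: btl_model and n d :: nat
  defines "n \<equiv> theta_dim M" and "d \<equiv> num_items M"
  assumes setting: "btl_setting M"
begin

lemma q_vec_carrier: "q_vec M \<alpha> \<in> carrier_vec n"
proof (rule carrier_vecI)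
  have "null_mat M \<in> carrier_mat (num_features M) n"
    using setting by (simp add: btl_setting_def n_def)
  then show "dim_vec (q_vec M \<alpha>) = n"
    by (simp add: q_vec_def)
qed

lemma n_pos: "n \<ge> 1"
  using setting by (simp add: btl_setting_def n_def)

lemma scale_pos: "scale M > 0"
  using setting by (simp add: btl_setting_def)

lemma query_less:
  assumes "\<alpha> \<in> queries M"
  shows "fst \<alpha> < snd \<alpha>" "snd \<alpha> < d"
proof -
  have "queries M \<subseteq> {(i, j). i < j \<and> j < d}"
    using setting by (simp add: btl_setting_def d_def)
  then show "fst \<alpha> < snd \<alpha>" "snd \<alpha> < d"
    using assms by auto
qed

lemma queries_subset: "queries M \<subseteq> {..<d} \<times> {..<d}"
proof
  fix \<alpha> assume "\<alpha> \<in> queries M"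
  from query_less[OF this] show "\<alpha> \<in> {..<d} \<times> {..<d}"
    by (simp add: mem_Times_iff)
qed

lemma finite_queries: "finite (queries M)"
  by (rule finite_subset[OF queries_subset]) simp

text \<open>Queries are strictly increasing pairs, so they and their mirror images are disjoint
  parts of the \<open>d\<close> by \<open>d\<close> square. The factor \<open>2\<close> gained here
  cancels the one in the two-sided tail bound.\<close>

lemma card_queries_le: "2 * real (card (queries M)) \<le> (real d)\<^sup>2"
proof -
  have disjoint: "queries M \<inter> prod.swap ` queries M = {}"
  proof (rule equals0I)
    fix \<alpha> assume "\<alpha> \<in> queries M \<inter> prod.swap ` queries M"
    then obtain \<beta> where "\<alpha> \<in> queries M" "\<beta> \<in> queries M" "\<alpha> = prod.swap \<beta>" by blast
    then show False
      using query_less(1)[of \<alpha>] query_less(1)[of \<beta>] by simp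
  qed
  have "card (prod.swap ` queries M) = card (queries M)"
    by (rule card_image) simp
  then have "2 * card (queries M) = card (queries M \<union> prod.swap ` queries M)"
    using finite_queries disjoint by (simp add: card_Un_disjoint)
  also have "\<dots> \<le> card ({..<d} \<times> {..<d})"
    using queries_subset by (intro card_mono) auto
  also have "\<dots> = d\<^sup>2"
    by (simp add: power2_eq_square)
  finally have "real (2 * card (queries M)) \<le> real (d\<^sup>2)"
    by (simp only: of_nat_le_iff)
  then show ?thesis by simp
qed

lemma sample_size_pos: "sample_size M > 0"
proof -
  obtain \<alpha> where "\<alpha> \<in> queries M" "reps M \<alpha> \<ge> 1"
    using setting by (auto simp: btl_setting_def)
  then show ?thesis
    using finite_queries by (auto simp: sample_size_def intro!: sum_pos2)
qed

lemma finite_obs_index: "finite (obs_index M)"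
  using finite_queries by (auto simp: obs_index_def)

lemma finite_responses: "finite (responses M)"
  unfolding responses_def using finite_obs_index by (intro finite_PiE_dflt) auto

lemma sum_response_pmf: "(\<Sum>y\<in>responses M. pmf (response_pmf M \<theta>) y) = 1"
proof (rule sum_pmf_eq_1[OF finite_responses])
  show "set_pmf (response_pmf M \<theta>) \<subseteq> responses M"
    unfolding response_pmf_def
    by (rule order_trans[OF set_Pi_pmf_subset[OF finite_obs_index]])
       (auto simp: responses_def PiE_dflt_def)
qed

text \<open>Repetitions of a query contribute equal terms, so the hypothesis bounds the squared
  logit differences summed over all observations. The affinity exponent is then at most
  \<open>4/16\<close>, and \<open>exp (- 1/4) \<ge> 1 - 1/4\<close>.\<close>

lemma response_overlap:
  assumes "(\<Sum>\<alpha>\<in>queries M. real (reps M \<alpha>) * (eta M \<theta> \<alpha> - eta M \<theta>' \<alpha>)\<^sup>2) \<le> 4"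
  shows "(\<Sum>y\<in>responses M. min (pmf (response_pmf M \<theta>) y) (pmf (response_pmf M \<theta>') y)) \<ge> 1 / 2"
proof (rule sum_min_ge_half)
  have eq: "response_pmf M \<theta> = Pi_pmf (obs_index M) False
      (\<lambda>i. bernoulli_pmf (1 / (1 + exp (- eta M \<theta> (fst i)))))" for \<theta>
    by (simp add: response_pmf_def case_prod_unfold)
  have "(\<Sum>i\<in>obs_index M. (eta M \<theta> (fst i) - eta M \<theta>' (fst i))\<^sup>2)
      = (\<Sum>\<alpha>\<in>queries M. \<Sum>t<reps M \<alpha>. (eta M \<theta> \<alpha> - eta M \<theta>' \<alpha>)\<^sup>2)"
    unfolding obs_index_def using finite_queries
    by (subst sum.Sigma) (auto simp: case_prod_unfold)
  then have "(\<Sum>i\<in>obs_index M. (eta M \<theta> (fst i) - eta M \<theta>' (fst i))\<^sup>2) \<le> 4"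
    using assms by simp
  then have "exp (- 1 / 4) \<le> exp (- ((\<Sum>i\<in>obs_index M. (eta M \<theta> (fst i) - eta M \<theta>' (fst i))\<^sup>2) / 16))"
    by simp
  also have "\<dots> \<le> (\<Sum>y\<in>responses M. sqrt (pmf (response_pmf M \<theta>) y * pmf (response_pmf M \<theta>') y))\<^sup>2"
    unfolding eq responses_def by (rule Pi_bernoulli_bhattacharyya[OF finite_obs_index])
  finally show "3 / 4 \<le> (\<Sum>y\<in>responses M. sqrt (pmf (response_pmf M \<theta>) y * pmf (response_pmf M \<theta>') y))\<^sup>2"
    using exp_ge_add_one_self[of "- 1 / 4"] by linarith
qed (auto simp: sum_response_pmf)

text \<open>The design matrix is an average of the rank-one matrices of the
  \<open>q_vec M \<alpha>\<close>. At a unit eigenvector the right side is the sample size times the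
  eigenvalue, which measures the effect of one sign flip on the logits.\<close>

lemma design_quadratic_form:
  "(\<Sum>\<alpha>\<in>queries M. real (reps M \<alpha>) * (dot n x (vec_index (q_vec M \<alpha>)))\<^sup>2)
    = real (sample_size M) * dot n x (mat_app n (\<lambda>i j. design_mat M $$ (i, j)) x)"
proof -
  have "real (sample_size M) * dot n x (mat_app n (\<lambda>i j. design_mat M $$ (i, j)) x)
      = (\<Sum>i<n. \<Sum>j<n. x i * x j * (real (sample_size M) * design_mat M $$ (i, j)))"
    by (simp add: dot_def mat_app_def sum_distrib_left mult_ac)
  also have "\<dots> = (\<Sum>i<n. \<Sum>j<n. x i * x j *
      (\<Sum>\<alpha>\<in>queries M. real (reps M \<alpha>) * (q_vec M \<alpha> $ i * q_vec M \<alpha> $ j)))"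
    using sample_size_pos by (simp add: design_mat_def n_def)
  also have "\<dots> = (\<Sum>i<n. \<Sum>j<n. \<Sum>\<alpha>\<in>queries M.
      real (reps M \<alpha>) * ((x i * q_vec M \<alpha> $ i) * (x j * q_vec M \<alpha> $ j)))"
    by (simp add: sum_distrib_left mult_ac)
  also have "\<dots> = (\<Sum>i<n. \<Sum>\<alpha>\<in>queries M. \<Sum>j<n.
      real (reps M \<alpha>) * ((x i * q_vec M \<alpha> $ i) * (x j * q_vec M \<alpha> $ j)))"
    by (intro sum.cong refl sum.swap)
  also have "\<dots> = (\<Sum>\<alpha>\<in>queries M. \<Sum>i<n. \<Sum>j<n.
      real (reps M \<alpha>) * ((x i * q_vec M \<alpha> $ i) * (x j * q_vec M \<alpha> $ j)))"
    by (rule sum.swap)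
  also have "\<dots> = (\<Sum>\<alpha>\<in>queries M. real (reps M \<alpha>) * (dot n x (vec_index (q_vec M \<alpha>)))\<^sup>2)"
    unfolding dot_def power2_eq_square sum_product by (simp only: sum_distrib_left)
  finally show ?thesis by simp
qed

text \<open>The hypercube argument for one estimator: \<open>assouad_probability\<close> with
  \<open>G\<close> the sign vectors whose parameters are feasible. The first conjunct makes the
  threshold nonnegative, as Markov's inequality requires later.\<close>

lemma exists_parameter_with_large_error:
  fixes B :: real and est
  assumes B: "B > B_zero M" and pd: "pos_def_mat (design_mat M)"
    and est: "\<And>y. y \<in> responses M \<Longrightarrow> est y \<in> carrier_vec n"
  shows "mat_trace (design_inv M) * min_rate M B \<ge> 0 \<and>
    (\<exists>\<theta>\<in>param_set M B. measure (measure_pmf (response_pmf M \<theta>))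
      {y \<in> responses M. sq_norm2 (est y - \<theta>)
        \<ge> (scale M)\<^sup>2 * mat_trace (design_inv M) / 16 * min_rate M B} \<ge> 1 / 15)"
proof -
  have Wc: "design_mat M \<in> carrier_mat n n"
    by (simp add: design_mat_def n_def)
  obtain u l where on: "orthonormal_family n n u" and l_pos: "\<And>a. a < n \<Longrightarrow> l a > 0"
    and quad: "\<And>a. a < n \<Longrightarrow> dot n (u a) (mat_app n (\<lambda>i j. design_mat M $$ (i, j)) (u a)) = l a"
    and tr: "mat_trace (design_inv M) = (\<Sum>a<n. 1 / l a)"
    and inv_quad: "\<And>x. x \<in> carrier_vec n \<Longrightarrow>
      x \<bullet> (design_inv M *\<^sub>v x) = (\<Sum>a<n. (dot n (u a) (vec_index x))\<^sup>2 / l a)"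
    by (rule pos_def_mat_spectral[OF Wc pd, folded design_inv_def]) (rule that, blast+)
  define r where "r = min_rate M B"
  define \<sigma> where "\<sigma> = scale M"
  define T where "T = mat_trace (design_inv M)"
  define L where "L = ln (4 * real d)"
  define t where "t = ln (B / B_zero M)"
  define q where "q \<alpha> = vec_index (q_vec M \<alpha>)" for \<alpha>
  have d: "d \<ge> 2" using setting by (simp add: btl_setting_def d_def)
  have \<sigma>: "\<sigma> > 0" using scale_pos by (simp add: \<sigma>_def)
  have B0: "B_zero M > 0" by (simp add: B_zero_def)
  have t: "t > 0" using B B0 by (simp add: t_def)
  have L: "L > 0" using d by (simp add: L_def)
  have T: "T > 0"
    unfolding T_def tr using l_pos n_pos by (intro sum_pos) (auto simp: lessThan_empty_iff)
  have coh: "(\<Sum>a<n. (dot n (u a) (q \<alpha>))\<^sup>2 / l a) \<le> coherence M * real n" if "\<alpha> \<in> queries M" for \<alpha>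
  proof -
    have "1 / real n * (q_vec M \<alpha> \<bullet> (design_inv M *\<^sub>v q_vec M \<alpha>)) \<le> coherence M"
      unfolding coherence_def n_def using that finite_queries by (intro Max_ge) auto
    then show ?thesis
      using n_pos inv_quad[OF q_vec_carrier, of \<alpha>] by (simp add: q_def pos_divide_le_eq)
  qed
  have form_nonneg: "0 \<le> (\<Sum>a<n. (dot n (u a) (q \<alpha>))\<^sup>2 / l a)" for \<alpha>
    using l_pos by (intro sum_nonneg divide_nonneg_pos) auto
  obtain \<alpha>0 where "\<alpha>0 \<in> queries M"
    using setting by (auto simp: btl_setting_def)
  then have \<mu>: "0 \<le> coherence M * real n"
    using coh form_nonneg order_trans by blast
  have r_eq: "r = min (1 / real (sample_size M)) (t\<^sup>2 / (4 * L * (coherence M * real n)))"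
    by (simp add: r_def min_rate_def t_def L_def n_def d_def mult_ac)
  have r: "0 \<le> r" "r * real (sample_size M) \<le> 1"
  proof -
    show "0 \<le> r" using \<mu> L by (simp add: r_eq)
    have "r \<le> 1 / real (sample_size M)" by (simp add: r_eq)
    then show "r * real (sample_size M) \<le> 1"
      using sample_size_pos by (simp add: pos_le_divide_eq)
  qed
  have r_coh: "4 * L * (r * (coherence M * real n)) \<le> t\<^sup>2"
  \<comment> \<open>In the degenerate case the left side is \<open>0\<close>, whatever value
    division by zero gives to the rate.\<close>
  proof (cases "coherence M * real n = 0")
    case False
    then have "0 < coherence M * real n" using \<mu> by linarith
    then have "0 < 4 * L * (coherence M * real n)" using L by simp
    moreover have "r \<le> t\<^sup>2 / (4 * L * (coherence M * real n))" by (simp add: r_eq)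
    ultimately show ?thesis by (simp add: pos_le_divide_eq mult_ac)
  qed auto
  \<comment> \<open>Half the edge length of the cube in direction \<open>u a\<close>: directions
    with little design information get long edges, so that every flip is equally hard to
    detect.\<close>
  define c where "c a = \<sigma> * sqrt r / sqrt (l a)" for a
  have c_nonneg: "c a \<ge> 0" if "a < n" for a
    using \<sigma> r l_pos[OF that] by (simp add: c_def)
  have c_sq: "(c a)\<^sup>2 = \<sigma>\<^sup>2 * r / l a" if "a < n" for a
    using r l_pos[OF that] by (simp add: c_def power_mult_distrib power_divide)
  define \<theta> where "\<theta> \<epsilon> = Matrix.vec n (\<lambda>i. \<Sum>a<n. (\<epsilon> a * c a) * u a i)" for \<epsilon>
  have \<theta>_dot: "dot n x (vec_index (\<theta> \<epsilon>)) = (\<Sum>a<n. (\<epsilon> a * c a) * dot n x (u a))" for x \<epsilon>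
  proof -
    have "dot n x (vec_index (\<theta> \<epsilon>)) = dot n x (\<lambda>i. \<Sum>a<n. (\<epsilon> a * c a) * u a i)"
      by (intro dot_cong) (auto simp: \<theta>_def)
    then show ?thesis by (simp only: dot_sum_right)
  qed
  have \<theta>_carrier: "\<theta> \<epsilon> \<in> carrier_vec n" for \<epsilon>
    by (simp add: \<theta>_def)
  have eta_\<theta>: "eta M (\<theta> \<epsilon>) \<alpha> = (w_off M \<bullet> a_vec M \<alpha>) / \<sigma> + (\<Sum>a<n. \<epsilon> a * (c a / \<sigma> * dot n (u a) (q \<alpha>)))" for \<epsilon> \<alpha>
  proof -
    have "q_vec M \<alpha> \<bullet> \<theta> \<epsilon> = (\<Sum>a<n. (\<epsilon> a * c a) * dot n (q \<alpha>) (u a))"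
      unfolding q_def \<theta>_dot[symmetric] using \<theta>_carrier by (simp add: dot_vec_index)
    then show ?thesis
      by (simp add: eta_def \<sigma>_def[symmetric] add_divide_distrib sum_divide_distrib dot_commute[of n "q \<alpha>" "u _"] mult_ac)
  qed
  define G where "G = {\<epsilon> \<in> signs n. \<theta> \<epsilon> \<in> param_set M B}"
  have bad: "real (card (signs n - G)) \<le> 2 ^ n / 16"
  proof -
    define E where "E \<alpha> = {\<epsilon> \<in> signs n. t < \<bar>\<Sum>a<n. \<epsilon> a * (c a / \<sigma> * dot n (u a) (q \<alpha>))\<bar>}" for \<alpha>
    have "signs n - G \<subseteq> (\<Union>\<alpha>\<in>queries M. E \<alpha>)"
    proof
      fix \<epsilon> assume "\<epsilon> \<in> signs n - G"
      then have \<epsilon>: "\<epsilon> \<in> signs n" "\<theta> \<epsilon> \<notin> param_set M B" by (auto simp: G_def)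
      then obtain \<alpha> where \<alpha>: "\<alpha> \<in> queries M" "ln B < \<bar>eta M (\<theta> \<epsilon>) \<alpha>\<bar>"
        using \<theta>_carrier by (auto simp: param_set_def n_def not_le)
      \<comment> \<open>The offset uses at most \<open>ln (B_zero M)\<close> of the allowance
        \<open>ln B\<close>, which leaves the margin \<open>t\<close> for the random part.\<close>
      have "\<bar>(w_off M \<bullet> a_vec M \<alpha>) / \<sigma>\<bar> \<le> ln (B_zero M)"
        unfolding B_zero_def \<sigma>_def using \<alpha>(1) finite_queries by (simp only: ln_exp) (intro Max_ge, auto)
      moreover have "ln B = t + ln (B_zero M)"
        using B B0 by (simp add: t_def ln_div)
      ultimately have "t < \<bar>\<Sum>a<n. \<epsilon> a * (c a / \<sigma> * dot n (u a) (q \<alpha>))\<bar>"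
        using \<alpha>(2) unfolding eta_\<theta> by linarith
      then show "\<epsilon> \<in> (\<Union>\<alpha>\<in>queries M. E \<alpha>)" using \<alpha>(1) \<epsilon>(1) by (auto simp: E_def)
    qed
    moreover have "finite (\<Union>\<alpha>\<in>queries M. E \<alpha>)"
      using finite_queries finite_signs by (auto simp: E_def)
    ultimately have "card (signs n - G) \<le> card (\<Union>\<alpha>\<in>queries M. E \<alpha>)"
      by (intro card_mono)
    also have "\<dots> \<le> (\<Sum>\<alpha>\<in>queries M. card (E \<alpha>))"
      by (rule card_UN_le[OF finite_queries])
    finally have "real (card (signs n - G)) \<le> (\<Sum>\<alpha>\<in>queries M. real (card (E \<alpha>)))"
      by (simp only: of_nat_sum[symmetric] of_nat_le_iff)
    also have "\<dots> \<le> (\<Sum>\<alpha>\<in>queries M. 2 ^ n * (2 * exp (- 2 * L)))"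
    proof (rule sum_mono)
      fix \<alpha> assume \<alpha>: "\<alpha> \<in> queries M"
      \<comment> \<open>The variance proxy is \<open>r\<close> times the quadratic form of the
        inverse design matrix at \<open>q_vec M \<alpha>\<close>, which the coherence
        controls.\<close>
      have "(\<Sum>a<n. (c a / \<sigma> * dot n (u a) (q \<alpha>))\<^sup>2) = (\<Sum>a<n. r * ((dot n (u a) (q \<alpha>))\<^sup>2 / l a))"
        using \<sigma> by (intro sum.cong) (auto simp: power_mult_distrib power_divide c_sq)
      also have "\<dots> \<le> r * (coherence M * real n)"
        unfolding sum_distrib_left[symmetric] using coh[OF \<alpha>] r by (intro mult_left_mono) auto
      finally have "4 * L * (\<Sum>a<n. (c a / \<sigma> * dot n (u a) (q \<alpha>))\<^sup>2) \<le> 4 * L * (r * (coherence M * real n))"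
        using L by (intro mult_left_mono) auto
      then have "4 * L * (\<Sum>a<n. (c a / \<sigma> * dot n (u a) (q \<alpha>))\<^sup>2) \<le> t\<^sup>2"
        using r_coh by (rule order_trans)
      then show "real (card (E \<alpha>)) \<le> 2 ^ n * (2 * exp (- 2 * L))"
        unfolding E_def using t L by (intro card_signs_tail) auto
    qed
    \<comment> \<open>This is where the \<open>4\<close> in \<open>ln (4 * d)\<close> enters: the
      two-sided tail is \<open>2 / (16 * d\<^sup>2)\<close>, and at most
      \<open>d\<^sup>2 / 2\<close> queries leave a fraction of \<open>1/16\<close>.\<close>
    also have "exp (- 2 * L) = 1 / (16 * (real d)\<^sup>2)"
    proof -
      have "exp (2 * L) = (4 * real d)\<^sup>2"
        using d by (simp add: exp_double L_def)
      then show ?thesis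
        by (simp add: exp_minus inverse_eq_divide power_mult_distrib)
    qed
    also have "(\<Sum>\<alpha>\<in>queries M. 2 ^ n * (2 * (1 / (16 * (real d)\<^sup>2))))
        = 2 ^ n / 16 * ((2 * real (card (queries M))) / (real d)\<^sup>2)"
      by simp
    also have "\<dots> \<le> 2 ^ n / 16 * 1"
      using card_queries_le d by (intro mult_left_mono) (auto simp: pos_divide_le_eq)
    finally show ?thesis by simp
  qed
  \<comment> \<open>Normalised so that \<open>\<sigma>\<^sup>2 * T * r * w a\<close> is
    \<open>(c a)\<^sup>2\<close>, the least squared loss for a wrong sign.\<close>
  define w where "w a = 1 / l a / T" for a
  \<comment> \<open>The estimator is turned into a test for each sign by reading the sign of its
    coordinate along \<open>u a\<close>, with \<open>0\<close> counted as positive.\<close>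
  define h where "h y a = (if dot n (u a) (vec_index (est y)) \<ge> 0 then 1 else -1 :: real)" for y a
  have "\<exists>\<epsilon>\<in>G. (\<Sum>y\<in>{y \<in> responses M. 1 / 16 \<le> (\<Sum>a<n. w a * of_bool (h y a \<noteq> \<epsilon> a))}.
      pmf (response_pmf M (\<theta> \<epsilon>)) y) \<ge> 1 / 15"
  proof (rule assouad_probability)
    show "finite (responses M)" by (rule finite_responses)
    show "(\<Sum>a<n. w a) = 1"
      unfolding w_def sum_divide_distrib[symmetric] tr[symmetric] T_def[symmetric] using T by simp
    show "w a \<ge> 0" if "a < n" for a
      using l_pos[OF that] T by (simp add: w_def)
    show "real (card (signs n - G)) \<le> 2 ^ n / 16" by (rule bad)
    show "1 / 2 \<le> (\<Sum>y\<in>responses M. min (pmf (response_pmf M (\<theta> \<epsilon>)) y)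
        (pmf (response_pmf M (\<theta> (\<epsilon>(k := - \<epsilon> k)))) y))" if \<epsilon>: "\<epsilon> \<in> signs n" and k: "k < n" for \<epsilon> k
    proof (rule response_overlap)
      have "(eta M (\<theta> \<epsilon>) \<alpha> - eta M (\<theta> (\<epsilon>(k := - \<epsilon> k))) \<alpha>)\<^sup>2
          = 4 * r / l k * (dot n (u k) (q \<alpha>))\<^sup>2" for \<alpha>
      proof -
        let ?f = "\<lambda>a. c a / \<sigma> * dot n (u a) (q \<alpha>)"
        have "eta M (\<theta> \<epsilon>) \<alpha> - eta M (\<theta> (\<epsilon>(k := - \<epsilon> k))) \<alpha>
            = (\<Sum>a<n. \<epsilon> a * ?f a - (\<epsilon>(k := - \<epsilon> k)) a * ?f a)"
          unfolding eta_\<theta> sum_subtractf by simp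
        also have "\<dots> = (\<Sum>a<n. (2 * \<epsilon> a * ?f a) * of_bool (k = a))"
          by (intro sum.cong) auto
        also have "\<dots> = 2 * \<epsilon> k * ?f k"
          using k by (intro sum_of_bool_eq) auto
        finally have "(eta M (\<theta> \<epsilon>) \<alpha> - eta M (\<theta> (\<epsilon>(k := - \<epsilon> k))) \<alpha>)\<^sup>2 = (2 * \<epsilon> k * ?f k)\<^sup>2"
          by simp
        also have "\<dots> = 4 * (\<epsilon> k)\<^sup>2 * ((c k)\<^sup>2 / \<sigma>\<^sup>2) * (dot n (u k) (q \<alpha>))\<^sup>2"
          by (simp add: power_mult_distrib power_divide)
        also have "(\<epsilon> k)\<^sup>2 = 1"
          using signs_cases[OF \<epsilon> k] by auto
        also have "4 * 1 * ((c k)\<^sup>2 / \<sigma>\<^sup>2) * (dot n (u k) (q \<alpha>))\<^sup>2 = 4 * r / l k * (dot n (u k) (q \<alpha>))\<^sup>2"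
          using \<sigma> by (simp add: c_sq[OF k])
        finally show ?thesis .
      qed
      then have "(\<Sum>\<alpha>\<in>queries M. real (reps M \<alpha>) *
            (eta M (\<theta> \<epsilon>) \<alpha> - eta M (\<theta> (\<epsilon>(k := - \<epsilon> k))) \<alpha>)\<^sup>2)
          = (\<Sum>\<alpha>\<in>queries M. 4 * r / l k * (real (reps M \<alpha>) * (dot n (u k) (q \<alpha>))\<^sup>2))"
        by (simp add: mult_ac)
      \<comment> \<open>The information \<open>l k\<close> in direction \<open>u k\<close> cancels
        the edge scaling \<open>1 / l k\<close>, so the bound is the same for every
        \<open>k\<close>.\<close>
      also have "\<dots> = 4 * r / l k * (real (sample_size M) * l k)"
        unfolding sum_distrib_left[symmetric] q_def design_quadratic_form quad[OF k] ..
      also have "\<dots> = 4 * (r * real (sample_size M))"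
        using l_pos[OF k] by simp
      also have "\<dots> \<le> 4"
        using r by simp
      finally show "(\<Sum>\<alpha>\<in>queries M. real (reps M \<alpha>) *
            (eta M (\<theta> \<epsilon>) \<alpha> - eta M (\<theta> (\<epsilon>(k := - \<epsilon> k))) \<alpha>)\<^sup>2) \<le> 4" .
    qed
  qed (auto simp: sum_response_pmf G_def)
  then obtain \<epsilon> where \<epsilon>: "\<epsilon> \<in> signs n" "\<theta> \<epsilon> \<in> param_set M B"
    and prob: "(\<Sum>y\<in>{y \<in> responses M. 1 / 16 \<le> (\<Sum>a<n. w a * of_bool (h y a \<noteq> \<epsilon> a))}.
      pmf (response_pmf M (\<theta> \<epsilon>)) y) \<ge> 1 / 15"
    by (auto simp: G_def)
  have loss: "\<sigma>\<^sup>2 * T * r * (\<Sum>a<n. w a * of_bool (h y a \<noteq> \<epsilon> a)) \<le> sq_norm2 (est y - \<theta> \<epsilon>)"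
    if y: "y \<in> responses M" for y
  proof -
    define v where "v = est y - \<theta> \<epsilon>"
    have v: "v \<in> carrier_vec n" using est[OF y] \<theta>_carrier by (simp add: v_def)
    have coord: "dot n (u a) (vec_index v) = dot n (u a) (vec_index (est y)) - \<epsilon> a * c a" if a: "a < n" for a
    proof -
      have "dot n (u a) (vec_index v)
          = dot n (u a) (\<lambda>i. est y $ i - \<theta> \<epsilon> $ i)"
        using est[OF y] \<theta>_carrier[of \<epsilon>] by (intro dot_cong) (auto simp: v_def)
      also have "\<dots> = dot n (u a) (vec_index (est y)) - (\<Sum>b<n. (\<epsilon> b * c b) * of_bool (a = b))"
        unfolding dot_diff_right \<theta>_dot using on a by (simp add: orthonormal_family_def)
      also have "(\<Sum>b<n. (\<epsilon> b * c b) * of_bool (a = b)) = \<epsilon> a * c a"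
        using a by (intro sum_of_bool_eq) auto
      finally show ?thesis .
    qed
    have "\<sigma>\<^sup>2 * T * r * (\<Sum>a<n. w a * of_bool (h y a \<noteq> \<epsilon> a))
        = (\<Sum>a<n. (c a)\<^sup>2 * of_bool (h y a \<noteq> \<epsilon> a))"
      unfolding sum_distrib_left using T by (intro sum.cong) (auto simp: w_def c_sq)
    also have "\<dots> \<le> (\<Sum>a<n. (dot n (u a) (vec_index v))\<^sup>2)"
    proof (rule sum_mono)
      fix a assume "a \<in> {..<n}"
      then have a: "a < n" by simp
      \<comment> \<open>A wrong sign puts the estimated coordinate at \<open>0\<close> or on the
        side of \<open>0\<close> opposite to \<open>\<epsilon> a * c a\<close>, hence at distance at
        least \<open>c a\<close>.\<close>
      have "\<bar>c a\<bar> \<le> \<bar>dot n (u a) (vec_index v)\<bar>" if "h y a \<noteq> \<epsilon> a"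
        using that signs_cases[OF \<epsilon>(1) a] c_nonneg[OF a] unfolding coord[OF a]
        by (auto simp: h_def split: if_splits)
      then show "(c a)\<^sup>2 * of_bool (h y a \<noteq> \<epsilon> a) \<le> (dot n (u a) (vec_index v))\<^sup>2"
        by (auto simp: abs_le_square_iff)
    qed
    also have "\<dots> = dot n (vec_index v) (vec_index v)"
      by (rule parseval[OF on, symmetric])
    also have "\<dots> = sq_norm2 v"
      using v by (simp add: dot_vec_index sq_norm2_def)
    finally show ?thesis by (simp add: v_def)
  qed
  let ?S = "{y \<in> responses M. sq_norm2 (est y - \<theta> \<epsilon>) \<ge> \<sigma>\<^sup>2 * T / 16 * r}"
  have "1 / 15 \<le> measure (measure_pmf (response_pmf M (\<theta> \<epsilon>)))
      {y \<in> responses M. 1 / 16 \<le> (\<Sum>a<n. w a * of_bool (h y a \<noteq> \<epsilon> a))}"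
    using prob finite_responses by (subst measure_measure_pmf_finite) auto
  also have "\<dots> \<le> measure (measure_pmf (response_pmf M (\<theta> \<epsilon>))) ?S"
  proof (intro measure_pmf.finite_measure_mono subsetI)
    fix y assume "y \<in> {y \<in> responses M. 1 / 16 \<le> (\<Sum>a<n. w a * of_bool (h y a \<noteq> \<epsilon> a))}"
    then have y: "y \<in> responses M" "1 / 16 \<le> (\<Sum>a<n. w a * of_bool (h y a \<noteq> \<epsilon> a))" by auto
    have "\<sigma>\<^sup>2 * T / 16 * r = \<sigma>\<^sup>2 * T * r * (1 / 16)" by simp
    also have "\<dots> \<le> \<sigma>\<^sup>2 * T * r * (\<Sum>a<n. w a * of_bool (h y a \<noteq> \<epsilon> a))"
      using y(2) T r by (intro mult_left_mono) auto
    also have "\<dots> \<le> sq_norm2 (est y - \<theta> \<epsilon>)" by (rule loss[OF y(1)])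
    finally show "y \<in> ?S" using y(1) by simp
  qed simp
  finally have "1 / 15 \<le> measure (measure_pmf (response_pmf M (\<theta> \<epsilon>))) ?S" .
  moreover have "T * r \<ge> 0" using T r by simp
  ultimately show ?thesis
    using \<epsilon>(2) unfolding T_def r_def \<sigma>_def by (intro conjI bexI[of _ "\<theta> \<epsilon>"])
qed

end

section \<open>From single estimators to the minimax risk and probability\<close>

theorem theorem3p1:
  shows "\<exists>c0 :: real. c0 > 0 \<and>
    (\<forall>(M :: btl_model) (B :: real).
      btl_setting M \<longrightarrow> B > 1 \<longrightarrow> B > B_zero M \<longrightarrow> pos_def_mat (design_mat M) \<longrightarrow>
        (INF est \<in> estimators M B. SUP \<theta> \<in> param_set M B. risk M est \<theta>)
          \<ge> ennreal (c0 * (scale M)\<^sup>2 * mat_trace (design_inv M) * min_rate M B)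
      \<and> (INF est \<in> estimators M B. SUP \<theta> \<in> param_set M B.
           emeasure (measure_pmf (response_pmf M \<theta>))
             {y \<in> responses M. sq_norm2 (est y - \<theta>)
                \<ge> (scale M)\<^sup>2 * mat_trace (design_inv M) / 16 * min_rate M B})
          \<ge> ennreal (1 / 15))"
proof (intro exI[of _ "1 / 240"] conjI allI impI)
  fix M :: btl_model and B :: real
  assume M: "btl_setting M" and B: "B > B_zero M" and pd: "pos_def_mat (design_mat M)"
  define s where "s = (scale M)\<^sup>2 * mat_trace (design_inv M) / 16 * min_rate M B"
  let ?S = "\<lambda>est \<theta>. {y \<in> responses M. s \<le> sq_norm2 (est y - \<theta>)}"
  \<comment> \<open>Both facts are stated for a given estimator, which suffices because the infima
    are bounded estimator by estimator.\<close>
  have key: "\<exists>\<theta>\<in>param_set M B. ennreal (1 / 15) \<le> emeasure (measure_pmf (response_pmf M \<theta>)) (?S est \<theta>)"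
    and s: "s \<ge> 0" if "est \<in> estimators M B" for est
  proof -
    have carrier: "est y \<in> carrier_vec (theta_dim M)" if "y \<in> responses M" for y
      using \<open>est \<in> estimators M B\<close> that by (auto simp: estimators_def)
    note * = exists_parameter_with_large_error[where est = est, OF M B pd carrier, folded s_def]
    show "\<exists>\<theta>\<in>param_set M B. ennreal (1 / 15) \<le> emeasure (measure_pmf (response_pmf M \<theta>)) (?S est \<theta>)"
      using * unfolding measure_pmf.emeasure_eq_measure by (blast intro: ennreal_leI)
    have "0 \<le> (scale M)\<^sup>2 / 16 * (mat_trace (design_inv M) * min_rate M B)"
      by (intro mult_nonneg_nonneg[OF _ conjunct1[OF *]]) auto
    then show "s \<ge> 0" by (simp add: s_def)
  qed
  show "ennreal (1 / 15) \<le> (INF est \<in> estimators M B. SUP \<theta> \<in> param_set M B.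
      emeasure (measure_pmf (response_pmf M \<theta>)) {y \<in> responses M. sq_norm2 (est y - \<theta>)
        \<ge> (scale M)\<^sup>2 * mat_trace (design_inv M) / 16 * min_rate M B})"
    unfolding s_def[symmetric]
  proof (rule INF_greatest)
    fix est assume "est \<in> estimators M B"
    then obtain \<theta> where "\<theta> \<in> param_set M B"
      "ennreal (1 / 15) \<le> emeasure (measure_pmf (response_pmf M \<theta>)) (?S est \<theta>)"
      using key by blast
    then show "ennreal (1 / 15)
        \<le> (SUP \<theta> \<in> param_set M B. emeasure (measure_pmf (response_pmf M \<theta>)) (?S est \<theta>))"
      by (rule SUP_upper2)
  qed
  have "ennreal (s / 15) \<le> (SUP \<theta> \<in> param_set M B. risk M est \<theta>)" if est: "est \<in> estimators M B" for est
  proof -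
    obtain \<theta> where \<theta>: "\<theta> \<in> param_set M B"
      and prob: "ennreal (1 / 15) \<le> emeasure (measure_pmf (response_pmf M \<theta>)) (?S est \<theta>)"
      using key[OF est] by blast
    \<comment> \<open>Markov's inequality: the loss is at least \<open>s\<close> on an event of
      probability at least \<open>1/15\<close>. As \<open>s\<close> carries the factor
      \<open>1/16\<close>, the constant is \<open>1/240\<close>.\<close>
    have "ennreal (s / 15) = ennreal s * ennreal (1 / 15)"
      using s[OF est] by (simp add: ennreal_mult[symmetric])
    also have "\<dots> \<le> ennreal s * emeasure (measure_pmf (response_pmf M \<theta>)) (?S est \<theta>)"
      using prob by (intro mult_left_mono) auto
    also have "\<dots> = (\<integral>\<^sup>+ y. ennreal s * indicator (?S est \<theta>) y \<partial>measure_pmf (response_pmf M \<theta>))"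
      by (subst nn_integral_cmult_indicator) auto
    also have "\<dots> \<le> risk M est \<theta>"
      unfolding risk_def by (intro nn_integral_mono) (auto simp: indicator_def intro: ennreal_leI)
    finally show ?thesis using \<theta> by (rule SUP_upper2[rotated])
  qed
  then show "ennreal (1 / 240 * (scale M)\<^sup>2 * mat_trace (design_inv M) * min_rate M B)
      \<le> (INF est \<in> estimators M B. SUP \<theta> \<in> param_set M B. risk M est \<theta>)"
    by (intro INF_greatest) (simp add: s_def mult_ac)
qed simp

end
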